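(* Let $\mu=(\mu_1,\dots,\mu_k)$ be a composition of $n$ and let $\pi_{0,\mu}\in\mathrm{I}_\mu$ be the $\mu$-involution whose $i$-th $\mu$-string is $[\,n-\nu_{i-1},\ n-\nu_{i-1}-1,\ \dots,\ n-\nu_i+1\,]$ for each $i$ (the maximal element of the reverse weak order on $\mathrm{I}_\mu$; e.g. $\pi_{0,(4,2)}=[6543|21]$). Then $$W(\pi_{0,\mu})=\mathrm{D}_\mu .$$
   Context: $\mathrm{S}_n$ is the symmetric group on $[n]$, permutations in one-line notation, products are compositions $(uv)(x)=u(v(x))$, $s_j=(j,j+1)$, $\ell(w)$ the number of inversions. A composition $\mu=(\mu_1,\dots,\mu_k)$ of $n$ is a sequence of positive integers summing to $n$; $\nu_j=\mu_1+\cdots+\mu_j$, $\nu_0=0$. The $i$-th $\mu$-string of $\pi\in\mathrm{S}_n$ is $\alpha_i=[\pi(\nu_{i-1}+1),\dots,\pi(\nu_i)]$, written $\pi=[\alpha_1|\cdots|\alpha_k]$. A string $\alpha$ with entry set $A$ is regarded as the permutation of $A$ sending the $m$-th smallest element of $A$ to the $m$-th entry of $\alpha$ (equivalently, via relative order, a permutation of $\{1,\dots,|A|\}$). $\pi$ is a $\mu$-involution if every $\mu$-string is an involution in this sense; $\mathrm{I}_\mu$ is the set of $\mu$-involutions. Action: for $\pi\in\mathrm{I}_\mu$ and $1\le j\le n-1$: if $\pi^{-1}(j)>\pi^{-1}(j+1)$ then $s_j\cdot\pi=\pi$; if $\pi^{-1}(j)<\pi^{-1}(j+1)$ and $j,j+1$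 lie in different $\mu$-strings, then $s_j\cdot\pi=s_j\pi$; if $\pi^{-1}(j)<\pi^{-1}(j+1)$ and $j,j+1$ lie in the same string $\alpha_m$, then $s_j\cdot\pi$ replaces $\alpha_m$ by $s_j\alpha_m$ (swap entries $j$ and $j+1$) if $\alpha_m$ fixes both $j$ and $j+1$, and by $s_j\alpha_m s_j$ otherwise. This satisfies $s_j\cdot(s_j\cdot\pi)=s_j\cdot\pi$, commutation for $|i-j|>1$, and the braid relation $s_j\cdot s_{j+1}\cdot s_j\cdot=s_{j+1}\cdot s_j\cdot s_{j+1}\cdot$, so $w\cdot\pi$ is well defined for $w\in\mathrm{S}_n$ via any reduced expression (letters acting right to left). The reverse weak order on $\mathrm{I}_\mu$ is $\pi\le\pi'$ iff $\pi'=w\cdot\pi$ for some $w$; it is graded with minimum $e=[1\,2\cdots n]$, and $\ell_\mu(\pi)$ denotes the rank of $\pi$ (the length of any maximal chain from $e$ to $\pi$). $W$-set: $W(\pi)=\{w\in\mathrm{S}_n: w\cdot e=\pi\ \text{and}\ \ell(w)=\ell_\mu(\pi)\}$. For $m\ge1$, $\mathrm{D}_m$ is the set of $w\in\mathrm{S}_m$ such that for every $i$ with $1\le i\le m/2$: $w^{-1}(m+1-i)<w^{-1}(i)$ and there is no $j$ with $i<j<m+1-i$ and $w^{-1}(m+1-i)<w^{-1}(j)<w^{-1}(i)$. $\mathrm{D}_\mu$ is the set of $w\in\mathrm{S}_n$ such that for each $i$, the $i$-th $\mu$-string of $w$ has entry set $\{j: n-\nu_i<j\le n-\nu_{i-1}\}$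 and its associated permutation (by relative order) lies in $\mathrm{D}_{\mu_i}$. (E.g. $\mathrm{D}_{(4,2)}=\{[5463|21],[5634|21],[6354|21]\}$.) *)

theory Defs
  imports "HOL-Combinatorics.Permutations"
begin

text \<open>
  Elements of \<open>S\<^sub>n\<close> are functions \<open>w :: nat \<Rightarrow> nat\<close> with \<open>w permutes {1..n}\<close>.
  A composition of \<open>n\<close> is a list \<open>mu\<close>; functions depending on \<open>mu\<close> recover \<open>n\<close> as
  \<open>sum_list mu\<close>. Entries and positions are numbered from 1, as in one-line notation, but the parts
  of \<open>mu\<close> and the strings are numbered from 0 as list elements are: string \<open>i\<close> occupies
  the positions \<open>x\<close> with \<open>nu mu i < x \<le> nu mu (i + 1)\<close>.
\<close>

definition composition :: "nat \<Rightarrow> nat list \<Rightarrow> bool" where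
  "composition n mu \<longleftrightarrow> (\<forall>m\<in>set mu. 0 < m) \<and> sum_list mu = n"

definition nu :: "nat list \<Rightarrow> nat \<Rightarrow> nat" where
  "nu mu i = sum_list (take i mu)"


subsection \<open>Simple transpositions, length, reduced expressions\<close>

definition simple_transp :: "nat \<Rightarrow> nat \<Rightarrow> nat" where
  "simple_transp j = transpose j (j + 1)"

definition perm_length :: "nat \<Rightarrow> (nat \<Rightarrow> nat) \<Rightarrow> nat" where
  "perm_length n w = card {(x, y). 1 \<le> x \<and> x < y \<and> y \<le> n \<and> w y < w x}"

definition reduced_expression :: "nat \<Rightarrow> nat list \<Rightarrow> (nat \<Rightarrow> nat) \<Rightarrow> bool" where
  "reduced_expression n js w \<longleftrightarrow>
     set js \<subseteq> {1..<n} \<and> foldr (\<lambda>j v. simple_transp j \<circ> v) js id = w \<and> length js = perm_length n w"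


subsection \<open>Strings\<close>

definition mu_string :: "nat list \<Rightarrow> nat \<Rightarrow> (nat \<Rightarrow> nat) \<Rightarrow> nat list" where
  "mu_string mu i p = map p [nu mu i + 1 ..< nu mu (i + 1) + 1]"

definition mu_strings :: "nat list \<Rightarrow> (nat \<Rightarrow> nat) \<Rightarrow> nat list list" where
  "mu_strings mu p = map (\<lambda>i. mu_string mu i p) [0..<length mu]"

text \<open>The permutation written \<open>[\<alpha>\<^sub>1|\<dots>|\<alpha>\<^sub>k]\<close>.\<close>

definition of_strings :: "nat list list \<Rightarrow> nat \<Rightarrow> nat" where
  "of_strings as x =
     (if 1 \<le> x \<and> x \<le> length (concat as) then concat as ! (x - 1) else x)"

text \<open>
  A string with distinct entries, entry set \<open>A\<close>, as a permutation of \<open>A\<close> (extended by the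
  identity): the \<open>m\<close>-th smallest element of \<open>A\<close> is sent to the \<open>m\<close>-th entry. Conversely,
  \<open>string_of A f\<close> is the string of the permutation \<open>f\<close> of \<open>A\<close>.
\<close>

definition string_perm :: "nat list \<Rightarrow> nat \<Rightarrow> nat" where
  "string_perm a = permutation_of_list (zip (sort a) a)"

definition string_of :: "nat set \<Rightarrow> (nat \<Rightarrow> nat) \<Rightarrow> nat list" where
  "string_of A f = map f (sorted_list_of_set A)"

text \<open>The same permutation transported to \<open>{1..length a}\<close> by relative order.\<close>

definition std_perm :: "nat list \<Rightarrow> nat \<Rightarrow> nat" where
  "std_perm a m =
     (if 1 \<le> m \<and> m \<le> length a then card {y \<in> set a. y \<le> a ! (m - 1)} else m)"

definition mu_involutions :: "nat list \<Rightarrow> (nat \<Rightarrow> nat) set" where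
  "mu_involutions mu =
     {p. p permutes {1..sum_list mu} \<and>
         (\<forall>i<length mu. string_perm (mu_string mu i p) \<circ> string_perm (mu_string mu i p) = id)}"


subsection \<open>The action and the reverse weak order\<close>

definition act_string :: "nat \<Rightarrow> nat list \<Rightarrow> nat list" where
  "act_string j a =
     (let s = simple_transp j; f = string_perm a in
      if f j = j \<and> f (j + 1) = j + 1 then string_of (set a) (s \<circ> f)
      else string_of (set a) (s \<circ> f \<circ> s))"

definition simple_act :: "nat list \<Rightarrow> nat \<Rightarrow> (nat \<Rightarrow> nat) \<Rightarrow> (nat \<Rightarrow> nat)" where
  "simple_act mu j p =
     (if inv p (j + 1) < inv p j then p
      else if \<exists>a\<in>set (mu_strings mu p). j \<in> set a \<and> j + 1 \<in> set a
        then of_strings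
               (map (\<lambda>a. if j \<in> set a \<and> j + 1 \<in> set a then act_string j a else a) (mu_strings mu p))
      else simple_transp j \<circ> p)"

text \<open>
  The result does not depend on the reduced expression chosen, because \<open>simple_act\<close> satisfies
  the commutation and braid relations on \<open>mu\<close>-involutions.
\<close>

definition perm_act :: "nat list \<Rightarrow> (nat \<Rightarrow> nat) \<Rightarrow> (nat \<Rightarrow> nat) \<Rightarrow> (nat \<Rightarrow> nat)" where
  "perm_act mu w p = foldr (simple_act mu) (SOME js. reduced_expression (sum_list mu) js w) p"

definition rev_weak_le :: "nat list \<Rightarrow> (nat \<Rightarrow> nat) \<Rightarrow> (nat \<Rightarrow> nat) \<Rightarrow> bool" where
  "rev_weak_le mu p q \<longleftrightarrow>
     p \<in> mu_involutions mu \<and> q \<in> mu_involutions mu \<and>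
     (\<exists>w. w permutes {1..sum_list mu} \<and> q = perm_act mu w p)"

text \<open>
  The common length of the maximal chains from the identity to \<open>p\<close>; a chain of length \<open>r\<close>
  has \<open>r + 1\<close> elements.
\<close>

definition mu_rank :: "nat list \<Rightarrow> (nat \<Rightarrow> nat) \<Rightarrow> nat" where
  "mu_rank mu p =
     (THE r. \<exists>C. pred_on.maxchain {q. rev_weak_le mu id q \<and> rev_weak_le mu q p} (rev_weak_le mu) C
               \<and> card C = r + 1)"

definition W_set :: "nat list \<Rightarrow> (nat \<Rightarrow> nat) \<Rightarrow> (nat \<Rightarrow> nat) set" where
  "W_set mu p =
     {w. w permutes {1..sum_list mu} \<and> perm_act mu w id = p \<and>
         perm_length (sum_list mu) w = mu_rank mu p}"

text \<open>The \<open>mu\<close>-involution whose string \<open>i\<close> is \<open>[n - nu mu i, \<dots>, n - nu mu (i + 1) + 1]\<close>.\<close>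

definition max_mu_involution :: "nat list \<Rightarrow> nat \<Rightarrow> nat" where
  "max_mu_involution mu =
     (let n = sum_list mu in
      of_strings (map (\<lambda>i. rev [n - nu mu (i + 1) + 1 ..< n - nu mu i + 1]) [0..<length mu]))"


subsection \<open>The sets \<open>D\<close>\<close>

definition D_set :: "nat \<Rightarrow> (nat \<Rightarrow> nat) set" where
  "D_set m =
     {w. w permutes {1..m} \<and>
         (\<forall>i. 1 \<le> i \<and> 2 * i \<le> m \<longrightarrow>
            inv w (m + 1 - i) < inv w i \<and>
            \<not> (\<exists>j. i < j \<and> j < m + 1 - i \<and>
                   inv w (m + 1 - i) < inv w j \<and> inv w j < inv w i))}"

definition D_mu :: "nat list \<Rightarrow> (nat \<Rightarrow> nat) set" where
  "D_mu mu =
     (let n = sum_list mu in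
      {w. w permutes {1..n} \<and>
          (\<forall>i<length mu.
             set (mu_string mu i w) = {j. n - nu mu (i + 1) < j \<and> j \<le> n - nu mu i} \<and>
             std_perm (mu_string mu i w) \<in> D_set (mu ! i))})"

end

theory Submission
  imports Defs
begin

text \<open>
  A \<open>\<mu>\<close>-involution amounts to a pair \<open>(b, f)\<close>: \<open>b\<close> sends a value to the string containing it, and
  \<open>f\<close> is the union of the involutions of the strings, acting on values. In these terms \<open>s\<^sub>j\<close>, when it
  acts strictly, multiplies \<open>f\<close> by \<open>s\<^sub>j\<close> or conjugates \<open>(b, f)\<close> by it. The elements \<open>w\<close> of the
  \<open>W\<close>-set of \<open>(b, f)\<close> have a local description in terms of \<open>u = w\<^sup>-\<^sup>1\<close>: every 2-cycle appears in
  decreasing order with no intermediate value in between, and non-nested cycles of a string appear in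
  order. This description is carried along by strict steps, and a left descent of \<open>w\<close> always comes
  from a strict step. Hence a word from the identity is strict if and only if it is a reduced word of
  a permutation with this description. Therefore reduced words of the same permutation act alike
  wherever this matters, and neither the braid relations nor Matsumoto's theorem is needed. For the
  maximal \<open>\<mu>\<close>-involution all cycles of a string are nested and the description is that of \<open>D\<^sub>\<mu>\<close>.
\<close>

subsection \<open>Reduced words\<close>

text \<open>The obstacle is that \<open>perm_act\<close> uses one unknown reduced expression, so
  neither compatibility with products nor transitivity of \<open>rev_weak_le\<close> comes for free,
  while \<open>mu_rank\<close> is a definite description over maximal chains. Transitivity is
  therefore proved for \<open>reaches\<close>, where words concatenate, and carried to the order
  only for elements above the identity; chains are measured by the closed formula \<open>rk\<close>,
  which every strict step raises by one. The description \<open>good\<close> is phrased through u =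
  \<open>inv w\<close> because replacing w by s_j w merely exchanges the values of u at j and j + 1.
  Its clause on non-nested cycles, fixed points included, makes strict steps reversible: if u puts j
  + 1 before j within a string, then f (j + 1) < f j, so a step can be undone there.\<close>

lemma simple_transp_involutory [simp]: "simple_transp j (simple_transp j x) = x"
  by (simp add: simple_transp_def)

lemma simple_transp_comp_self [simp]:
  "simple_transp j \<circ> simple_transp j = id"
  "simple_transp j \<circ> (simple_transp j \<circ> v) = v"
  "v \<circ> simple_transp j \<circ> simple_transp j = v"
  by (auto simp: fun_eq_iff)

lemma simple_transp_eq_iff [simp]: "simple_transp j x = simple_transp j y \<longleftrightarrow> x = y"
  by (metis simple_transp_involutory)

lemma simple_transp_at [simp]:
  "simple_transp j j = Suc j" "simple_transp j (Suc j) = j"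
  by (simp_all add: simple_transp_def)

lemma simple_transp_other: "x \<noteq> j \<Longrightarrow> x \<noteq> Suc j \<Longrightarrow> simple_transp j x = x"
  by (simp add: simple_transp_def)

lemma simple_transp_less_iff:
  "simple_transp j x < simple_transp j y \<longleftrightarrow>
     (x < y \<and> \<not> (x = j \<and> y = Suc j)) \<or> (x = Suc j \<and> y = j)"
  by (auto simp: simple_transp_def transpose_def)

lemma simple_transp_permutes:
  "j \<in> {1..<n} \<Longrightarrow> simple_transp j permutes {1..n}"
  unfolding simple_transp_def by (rule permutes_swap_id) auto

lemma simple_transp_comp_permutes:
  "w permutes {1..n} \<Longrightarrow> j \<in> {1..<n} \<Longrightarrow> simple_transp j \<circ> w permutes {1..n}"
  by (rule permutes_compose[OF _ simple_transp_permutes])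

lemma inv_simple_transp_comp:
  assumes "w permutes {1..n}"
  shows "inv (simple_transp j \<circ> w) = inv w \<circ> simple_transp j"
proof (rule inv_unique_comp)
  have "w \<circ> inv w = id" "inv w \<circ> w = id"
    using assms by (simp_all add: permutes_inv_o)
  then show "simple_transp j \<circ> w \<circ> (inv w \<circ> simple_transp j) = id"
    "inv w \<circ> simple_transp j \<circ> (simple_transp j \<circ> w) = id"
    by (auto simp: fun_eq_iff)
qed

section \<open>Words in simple transpositions and the length function\<close>

definition word_perm :: "nat list \<Rightarrow> nat \<Rightarrow> nat" where
  "word_perm js = foldr (\<lambda>j v. simple_transp j \<circ> v) js id"

lemma word_perm_simps [simp]:
  "word_perm [] = id" "word_perm (j # js) = simple_transp j \<circ> word_perm js"
  by (simp_all add: word_perm_def)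

lemma word_perm_append: "word_perm (js @ ks) = word_perm js \<circ> word_perm ks"
  by (induction js) (simp_all add: comp_assoc)

lemma word_perm_permutes: "set js \<subseteq> {1..<n} \<Longrightarrow> word_perm js permutes {1..n}"
proof (induction js)
  case Nil
  show ?case unfolding word_perm_simps by (rule permutes_id)
next
  case (Cons j js)
  then have "j \<in> {1..<n}" "word_perm js permutes {1..n}" by auto
  then show ?case unfolding word_perm_simps by (rule simple_transp_comp_permutes[rotated])
qed

text \<open>Only the relative order of the values j and j + 1 changes, so the inversion set gains
  exactly one pair, formed by their positions.\<close>

lemma perm_length_ascent:
  assumes w: "w permutes {1..n}" and j: "j \<in> {1..<n}" and asc: "inv w j < inv w (Suc j)"
  shows "perm_length n (simple_transp j \<circ> w) = Suc (perm_length n w)"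
proof -
  let ?I = "\<lambda>w. {(x, y). 1 \<le> x \<and> x < y \<and> y \<le> n \<and> w y < w x}"
  have inv_w: "inv w j \<in> {1..n}" "inv w (Suc j) \<in> {1..n}"
    using j permutes_in_image[OF permutes_inv[OF w]] by auto
  have w_eq: "w x = z \<longleftrightarrow> x = inv w z" for x z
    using permutes_inverses[OF w] by metis
  have "?I (simple_transp j \<circ> w) = insert (inv w j, inv w (Suc j)) (?I w)"
    using inv_w asc by (auto simp: simple_transp_less_iff w_eq)
  moreover have "(inv w j, inv w (Suc j)) \<notin> ?I w"
    using permutes_inverses[OF w] by simp
  moreover have "finite (?I w)"
    by (rule finite_subset[of _ "{1..n} \<times> {1..n}"]) auto
  ultimately show ?thesis by (simp add: perm_length_def)
qed

lemma perm_length_descent: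
  assumes w: "w permutes {1..n}" and j: "j \<in> {1..<n}" and desc: "inv w (Suc j) < inv w j"
  shows "perm_length n w = Suc (perm_length n (simple_transp j \<circ> w))"
  using perm_length_ascent[OF simple_transp_comp_permutes[OF w j] j] desc
  by (simp add: inv_simple_transp_comp[OF w])

lemma perm_length_simple_transp_comp_le:
  assumes "w permutes {1..n}" "j \<in> {1..<n}"
  shows "perm_length n (simple_transp j \<circ> w) \<le> Suc (perm_length n w)"
proof -
  have "inv w j \<noteq> inv w (Suc j)"
    using permutes_inverses[OF assms(1)] by (metis n_not_Suc_n)
  then show ?thesis
    using perm_length_ascent[OF assms] perm_length_descent[OF assms] by linarith
qed

lemma perm_length_id [simp]: "perm_length n id = 0"
proof -
  have "{(x, y). 1 \<le> x \<and> x < y \<and> y \<le> n \<and> id y < id x} = {}" by auto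
  then show ?thesis unfolding perm_length_def by (metis card.empty)
qed

lemma perm_length_word_comp_le:
  assumes "v permutes {1..n}" "set js \<subseteq> {1..<n}"
  shows "perm_length n (word_perm js \<circ> v) \<le> length js + perm_length n v"
  using assms(2)
proof (induction js)
  case (Cons j js)
  have "perm_length n (simple_transp j \<circ> (word_perm js \<circ> v)) \<le> Suc (perm_length n (word_perm js \<circ> v))"
    using Cons.prems
    by (intro perm_length_simple_transp_comp_le permutes_compose[OF assms(1) word_perm_permutes]) auto
  moreover have "perm_length n (word_perm js \<circ> v) \<le> length js + perm_length n v"
    by (rule Cons.IH) (use Cons.prems in simp)
  ultimately show ?case unfolding word_perm_simps comp_assoc length_Cons by linarith
qed simp

lemma perm_length_word_le: "set js \<subseteq> {1..<n} \<Longrightarrow> perm_length n (word_perm js) \<le> length js"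
  using perm_length_word_comp_le[OF permutes_id] by simp

lemma reduced_expression_iff:
  "reduced_expression n js w \<longleftrightarrow>
     set js \<subseteq> {1..<n} \<and> word_perm js = w \<and> length js = perm_length n w"
  by (simp add: reduced_expression_def word_perm_def)

lemma reduced_expression_Nil_iff: "reduced_expression n [] w \<longleftrightarrow> w = id"
  by (auto simp: reduced_expression_iff)

text \<open>If the first letter were an ascent of w, the tail would represent a permutation longer
  than w, hence of length exceeding its own number of letters.\<close>

lemma reduced_expression_ConsD:
  assumes "reduced_expression n (j # js) w"
  shows "j \<in> {1..<n}" "inv w (Suc j) < inv w j" "reduced_expression n js (simple_transp j \<circ> w)"
proof -
  have js: "set js \<subseteq> {1..<n}" and j: "j \<in> {1..<n}" and w: "w = simple_transp j \<circ> word_perm js"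
    and len: "perm_length n w = Suc (length js)"
    using assms by (auto simp: reduced_expression_iff)
  have tail: "simple_transp j \<circ> w = word_perm js" by (simp add: w)
  have perm: "w permutes {1..n}" "word_perm js permutes {1..n}"
    using word_perm_permutes[OF js] simple_transp_comp_permutes[OF _ j] unfolding w by blast+
  show desc: "inv w (Suc j) < inv w j"
  proof (rule ccontr)
    assume "\<not> inv w (Suc j) < inv w j"
    moreover have "inv w j \<noteq> inv w (Suc j)"
      using permutes_inverses[OF perm(1)] by (metis n_not_Suc_n)
    ultimately have "perm_length n (word_perm js) = Suc (perm_length n w)"
      using perm_length_ascent[OF perm(1) j] tail by simp
    then show False using perm_length_word_le[OF js] len by simp
  qed
  show "reduced_expression n js (simple_transp j \<circ> w)"
    using perm_length_descent[OF perm(1) j desc] tail js len by (simp add: reduced_expression_iff)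
  show "j \<in> {1..<n}" by fact
qed

lemma permutes_increasing_eq_id:
  assumes u: "u permutes {1..n}" and inc: "\<And>j. j \<in> {1..<n} \<Longrightarrow> u j < u (Suc j)"
  shows "u = id"
proof -
  have ge: "x \<le> u x" if "x \<in> {1..n}" for x
    using that
  proof (induction x)
    case (Suc x)
    show ?case
    proof (cases "x = 0")
      case True
      then show ?thesis using Suc.prems permutes_in_image[OF u, of "Suc x"] by auto
    next
      case False
      then have "x \<le> u x" "u x < u (Suc x)" using Suc inc[of x] by auto
      then show ?thesis by simp
    qed
  qed simp
  \<comment> \<open>A permutation of \<open>{1..n}\<close> preserves the sum, so the termwise bound
    \<open>x \<le> u x\<close> must be an equality throughout.\<close>
  have sum_eq: "(\<Sum>x\<in>{1..n}. u x) = (\<Sum>x\<in>{1..n}. x)"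
    using sum.permute[OF u, of id] by simp
  have "u x = x" if "x \<in> {1..n}" for x
    using sum_mono_inv[OF sum_eq[symmetric], of x] ge that by auto
  then show ?thesis using u by (auto simp: fun_eq_iff permutes_def)
qed

text \<open>Removing left descents shortens the permutation and stops only at the identity. This is
  what gives the choice made in \<open>perm_act\<close> a witness.\<close>

lemma reduced_expression_exists:
  "w permutes {1..n} \<Longrightarrow> \<exists>js. reduced_expression n js w"
proof (induction "perm_length n w" arbitrary: w rule: less_induct)
  case less
  show ?case
  proof (cases "\<exists>j\<in>{1..<n}. inv w (Suc j) < inv w j")
    case True
    then obtain j where j: "j \<in> {1..<n}" "inv w (Suc j) < inv w j" by blast
    have len: "perm_length n w = Suc (perm_length n (simple_transp j \<circ> w))"
      using perm_length_descent[OF less.prems j] .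
    moreover have "simple_transp j \<circ> w permutes {1..n}"
      using simple_transp_comp_permutes[OF less.prems j(1)] .
    ultimately obtain js where "reduced_expression n js (simple_transp j \<circ> w)"
      using less.hyps by force
    then have "reduced_expression n (j # js) w"
      using j len by (auto simp: reduced_expression_iff)
    then show ?thesis ..
  next
    case False
    have "inv w j < inv w (Suc j)" if "j \<in> {1..<n}" for j
      using that False permutes_inverses[OF less.prems] by (metis linorder_neqE_nat n_not_Suc_n)
    then have "inv w = id"
      using permutes_increasing_eq_id[OF permutes_inv[OF less.prems]] by blast
    then have "w = id"
      using permutes_inv_inv[OF less.prems] by (simp add: inv_id)
    then show ?thesis using reduced_expression_Nil_iff by blast
  qed
qed

subsection \<open>Involutions compatible with a block structure\<close>

text \<open>In its string a value x stands at the place belonging to f x, so comparing first b and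
  then f compares positions. Left multiplication across strings and conjugation inside a string
  share the last branch: inside a string b agrees on j and j + 1, so composing it with s_j changes
  nothing.\<close>

definition simple_step ::
    "nat \<Rightarrow> (nat \<Rightarrow> nat) \<times> (nat \<Rightarrow> nat) \<Rightarrow> (nat \<Rightarrow> nat) \<times> (nat \<Rightarrow> nat)" where
  "simple_step j S = (case S of (b, f) \<Rightarrow>
     if b (Suc j) < b j \<or> b j = b (Suc j) \<and> f (Suc j) < f j then (b, f)
     else if b j = b (Suc j) \<and> f j = j \<and> f (Suc j) = Suc j then (b, simple_transp j \<circ> f)
     else (b \<circ> simple_transp j, simple_transp j \<circ> f \<circ> simple_transp j))"

text \<open>The argument \<open>u\<close> is the inverse of the permutation in question: it sends a value to its position.\<close>

definition good :: "nat \<Rightarrow> (nat \<Rightarrow> nat) \<Rightarrow> (nat \<Rightarrow> nat) \<times> (nat \<Rightarrow> nat) \<Rightarrow> bool" where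
  "good n u S = (case S of (b, f) \<Rightarrow>
     (\<forall>x. x < f x \<longrightarrow> u (f x) < u x \<and> (\<forall>e. x < e \<and> e < f x \<longrightarrow> \<not> (u (f x) < u e \<and> u e < u x))) \<and>
     (\<forall>x\<in>{1..n}. \<forall>y\<in>{1..n}. b x = b y \<and> x < y \<and> f x < f y \<longrightarrow> u x < u y \<and> u x < u (f y)))"

lemma goodI:
  assumes "\<And>x. x < f x \<Longrightarrow> u (f x) < u x"
    and "\<And>x e. x < e \<Longrightarrow> e < f x \<Longrightarrow> u (f x) < u e \<Longrightarrow> u e < u x \<Longrightarrow> False"
    and "\<And>x y. x \<in> {1..n} \<Longrightarrow> y \<in> {1..n} \<Longrightarrow> b x = b y \<Longrightarrow> x < y \<Longrightarrow> f x < f y \<Longrightarrow> u x < u y \<and> u x < u (f y)"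
  shows "good n u (b, f)"
  unfolding good_def split using assms by blast

lemma goodD:
  assumes "good n u (b, f)"
  shows "x < f x \<Longrightarrow> u (f x) < u x"
    and "x < e \<Longrightarrow> e < f x \<Longrightarrow> u (f x) < u e \<Longrightarrow> u e < u x \<Longrightarrow> False"
    and "x \<in> {1..n} \<Longrightarrow> y \<in> {1..n} \<Longrightarrow> b x = b y \<Longrightarrow> x < y \<Longrightarrow> f x < f y \<Longrightarrow> u x < u y \<and> u x < u (f y)"
  using assms by (simp_all add: good_def)

text \<open>Strict steps depend on the composition only through the weak monotonicity of
  \<open>blk\<close>, the map from positions to strings.\<close>

locale block_order =
  fixes n :: nat and blk :: "nat \<Rightarrow> nat"
  assumes blk_mono: "\<And>x y. x \<in> {1..n} \<Longrightarrow> y \<in> {1..n} \<Longrightarrow> x \<le> y \<Longrightarrow> blk x \<le> blk y"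
begin

text \<open>The witness u fixes the fibre sizes of b and makes b agree with \<open>blk\<close>
  outside \<open>{1..n}\<close>. It is quantified away because many placements of the values are
  compatible with the same b.\<close>

definition states :: "((nat \<Rightarrow> nat) \<times> (nat \<Rightarrow> nat)) set" where
  "states = {(b, f). (\<exists>u. u permutes {1..n} \<and> b = blk \<circ> u) \<and> f permutes {1..n} \<and>
     (\<forall>x. f (f x) = x) \<and> (\<forall>x. b (f x) = b x)}"

lemma statesD:
  assumes "(b, f) \<in> states"
  shows "f permutes {1..n}" "\<And>x. f (f x) = x" "\<And>x. b (f x) = b x"
  using assms by (auto simp: states_def)

lemma simple_transp_comp_eq:
  assumes "f j = j" "f (Suc j) = Suc j" "\<And>x. f (f x) = x"
  shows "simple_transp j \<circ> f = f \<circ> simple_transp j"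
proof
  fix x
  have "x = j \<or> x = Suc j \<or> (x \<noteq> j \<and> x \<noteq> Suc j \<and> f x \<noteq> j \<and> f x \<noteq> Suc j)"
    using assms by metis
  then show "(simple_transp j \<circ> f) x = (f \<circ> simple_transp j) x"
    using assms by (auto simp: simple_transp_other)
qed

lemma conj_states:
  assumes S: "(b, f) \<in> states" and j: "j \<in> {1..<n}"
  shows "(b \<circ> simple_transp j, simple_transp j \<circ> f \<circ> simple_transp j) \<in> states"
proof -
  obtain u where u: "u permutes {1..n}" "b = blk \<circ> u"
    using S by (auto simp: states_def)
  have "u \<circ> simple_transp j permutes {1..n}"
    by (rule permutes_compose[OF simple_transp_permutes[OF j] u(1)])
  moreover have "simple_transp j \<circ> f \<circ> simple_transp j permutes {1..n}"
    by (intro permutes_compose[of _ "{1..n}"] simple_transp_permutes[OF j] statesD(1)[OF S])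
  ultimately show ?thesis
    using statesD[OF S] u(2) by (auto simp: states_def comp_assoc)
qed

lemma left_mult_states:
  assumes S: "(b, f) \<in> states" and j: "j \<in> {1..<n}" and b: "b j = b (Suc j)"
    and comm: "simple_transp j \<circ> f = f \<circ> simple_transp j"
  shows "(b, simple_transp j \<circ> f) \<in> states"
proof -
  have "simple_transp j \<circ> f permutes {1..n}"
    by (rule simple_transp_comp_permutes[OF statesD(1)[OF S] j])
  moreover have "f (simple_transp j x) = simple_transp j (f x)" for x
    using comm by (metis comp_apply)
  moreover have "b (simple_transp j x) = b x" for x
    using b by (cases "x = j \<or> x = Suc j") (auto simp: simple_transp_other)
  ultimately show ?thesis
    using statesD[OF S] S by (auto simp: states_def)
qed

lemma simple_step_states:
  assumes S: "S \<in> states" and j: "j \<in> {1..<n}"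
  shows "simple_step j S \<in> states"
proof (cases S)
  case (Pair b f)
  note S' = S[unfolded Pair]
  have "(b, simple_transp j \<circ> f) \<in> states" if "b j = b (Suc j)" "f j = j" "f (Suc j) = Suc j"
    using that left_mult_states[OF S' j] simple_transp_comp_eq statesD(2)[OF S'] by blast
  then show ?thesis
    using S' conj_states[OF S' j] by (simp add: Pair simple_step_def)
qed

section \<open>How \<open>good\<close> changes under a step\<close>

text \<open>A weakly increasing \<open>blk\<close> has intervals of positions as fibres. Hence the
  intermediate values e in \<open>good\<close>, which range over all values, are confined to the
  string of the cycle.\<close>

lemma block_between:
  assumes u: "u permutes {1..n}" and b: "b = blk \<circ> u" and xy: "b x = b y" "x \<in> {1..n}" "y \<in> {1..n}"
    and e: "u x < u e" "u e < u y"
  shows "b e = b x"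
proof -
  have "u x \<in> {1..n}" "u y \<in> {1..n}"
    using xy permutes_in_image[OF u] by auto
  then have "u e \<in> {1..n}" using e by auto
  then have "blk (u x) \<le> blk (u e)" "blk (u e) \<le> blk (u y)"
    using e \<open>u x \<in> {1..n}\<close> \<open>u y \<in> {1..n}\<close> blk_mono by auto
  then show ?thesis using xy b by simp
qed

text \<open>The relabelling reverses only the order of j and j + 1, whereas \<open>good\<close>
  compares only values of a common string. Nothing is assumed about which of the two strings comes
  first, so the lemma serves both a strict step and its reversal.\<close>

lemma good_conj_distinct_blocks:
  assumes S: "(b, f) \<in> states" and j: "j \<in> {1..<n}"
    and u: "u permutes {1..n}" and b: "b = blk \<circ> u" and neq: "b j \<noteq> b (Suc j)"
    and G: "good n u (b, f)"
  shows "good n (u \<circ> simple_transp j) (b \<circ> simple_transp j, simple_transp j \<circ> f \<circ> simple_transp j)"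
proof -
  let ?s = "simple_transp j"
  have ord: "?s x < ?s y \<longleftrightarrow> x < y" if "b x = b y" for x y
    using that neq by (auto simp: simple_transp_less_iff)
  have range: "?s x \<in> {1..n}" if "x \<in> {1..n}" for x
    using that permutes_in_image[OF simple_transp_permutes[OF j]] by blast
  have inv: "x < y \<longleftrightarrow> ?s x < ?s y" if "b (?s x) = b (?s y)" for x y
    using ord[of "?s x" "?s y"] that by simp
  note f = statesD[OF S]
  have supp: "x \<in> {1..n}" "f x \<in> {1..n}" if "f x \<noteq> x" for x
  proof -
    show x: "x \<in> {1..n}" using that f(1) by (auto simp: permutes_def)
    then show "f x \<in> {1..n}" using permutes_in_image[OF f(1)] by blast
  qed
  show ?thesis
  proof (rule goodI, goal_cases)
    case (1 x)
    then have "?s x < f (?s x)" using ord[of "?s x" "f (?s x)"] f by simp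
    then show ?case using goodD(1)[OF G] by simp
  next
    case (2 x e)
    let ?x = "?s x" and ?e = "?s e"
    have lt: "?x < f ?x" using 2 ord[of "?s x" "f (?s x)"] f by (simp) 
    then have "?x \<in> {1..n}" "f ?x \<in> {1..n}" using supp[of ?x] by auto
    \<comment> \<open>Its position puts e between f x and x, hence in their string, where s_j
      reverses no comparison.\<close>
    then have be: "b ?e = b (f ?x)"
      using block_between[OF u b, of "f ?x" ?x ?e] 2 f(3) by simp
    then have "?x < ?e" "?e < f ?x"
      using 2 inv[of x e] inv[of e "?s (f ?x)"] f by simp_all
    then show False using 2 goodD(2)[OF G, of ?x ?e] by simp
  next
    case (3 x y)
    then show ?case
      using goodD(3)[OF G, of "?s x" "?s y"] range ord[of "f (?s x)" "f (?s y)"] inv[of x y] f by auto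
  qed
qed

text \<open>As fixed points of one string j and j + 1 are non-nested, so u places j first; the
  exchange turns them into a decreasing 2-cycle with no value strictly between its ends. Towards
  other cycles the pair behaves as the two fixed points did.\<close>

lemma good_left_mult:
  assumes S: "(b, f) \<in> states" and j: "j \<in> {1..<n}"
    and b: "b j = b (Suc j)" and fixd: "f j = j" "f (Suc j) = Suc j" and G: "good n u (b, f)"
  shows "good n (u \<circ> simple_transp j) (b, simple_transp j \<circ> f)"
proof -
  let ?s = "simple_transp j"
  note f = statesD[OF S]
  have lt: "u j < u (Suc j)"
    using goodD(3)[OF G, of j "Suc j"] j b fixd by auto
  have out: "f x \<noteq> j \<and> f x \<noteq> Suc j" if "x \<noteq> j" "x \<noteq> Suc j" for x
    using that fixd f by metis
  show ?thesis
  proof (rule goodI, goal_cases)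
    case (1 x)
    then show ?case using lt goodD(1)[OF G, of x] out[of x] fixd
      by (cases "x = j \<or> x = Suc j") (auto simp: simple_transp_other)
  next
    case (2 x e)
    show ?case
    proof (cases "x = j \<or> x = Suc j")
      case True
      then show ?thesis using 2 fixd by auto
    next
      case False
      then have "u (f x) < u (?s e)" "u (?s e) < u x" "x < e" "e < f x"
        using 2 out[of x] by (auto simp: simple_transp_other)
      moreover have "x < ?s e \<and> ?s e < f x"
        using calculation False out[of x] by (cases "e = j \<or> e = Suc j") (auto simp: simple_transp_other)
      ultimately show ?thesis using goodD(2)[OF G, of x "?s e"] by simp
    qed
  next
    case (3 x y)
    consider "x \<noteq> j" "x \<noteq> Suc j" "y \<noteq> j" "y \<noteq> Suc j" | "x \<noteq> j" "x \<noteq> Suc j" "y = j \<or> y = Suc j"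
      | "x = j \<or> x = Suc j" "y \<noteq> j" "y \<noteq> Suc j" | "x = j \<or> x = Suc j" "y = j \<or> y = Suc j" by blast
    then show ?case
    proof cases
      case 1
      then show ?thesis using 3 out[of x] out[of y] goodD(3)[OF G, of x y]
        by (simp add: simple_transp_other)
    next
      case 2
      \<comment> \<open>Both ends of the other cycle lie below j, and comparing it with the fixed
        point j, the earlier of the two, bounds both new positions at once.\<close>
      then have "x < j" "f x < j" "b x = b j" using 3 out[of x] fixd b by (auto simp: simple_transp_other)
      then have "u x < u j" using 3 j goodD(3)[OF G, of x j] fixd by auto
      then show ?thesis using 2 lt fixd by (auto simp: simple_transp_other)
    next
      case c3: 3
      then have "Suc j < y" "Suc j < f y" "b y = b (Suc j)"
        using 3 out[of y] fixd b by (auto simp: simple_transp_other)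
      then have "u (Suc j) < u y \<and> u (Suc j) < u (f y)"
        using 3 j goodD(3)[OF G, of "Suc j" y] fixd by auto
      then show ?thesis using c3 lt out[of y] fixd by (auto simp: simple_transp_other)
    next
      case 4
      then show ?thesis using 3 fixd by auto
    qed
  qed
qed

text \<open>Here \<open>u j < u (Suc j)\<close> is read off the decreasing 2-cycle instead of the
  clause on non-nested cycles; the other comparisons are those of
  \<open>good_left_mult\<close>.\<close>

lemma good_left_mult_converse:
  assumes S: "(b, f) \<in> states" and j: "j \<in> {1..<n}"
    and b: "b j = b (Suc j)" and fixd: "f j = j" "f (Suc j) = Suc j"
    and G: "good n (u \<circ> simple_transp j) (b, simple_transp j \<circ> f)"
  shows "good n u (b, f)"
proof -
  let ?s = "simple_transp j" and ?u = "u \<circ> simple_transp j" and ?f = "simple_transp j \<circ> f"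
  note f = statesD[OF S]
  have lt: "u j < u (Suc j)"
    using goodD(1)[OF G, of j] fixd by auto
  have out: "f x \<noteq> j \<and> f x \<noteq> Suc j" if "x \<noteq> j" "x \<noteq> Suc j" for x
    using that fixd f by metis
  show ?thesis
  proof (rule goodI, goal_cases)
    case (1 x)
    then show ?case using goodD(1)[OF G, of x] out[of x] fixd
      by (cases "x = j \<or> x = Suc j") (auto simp: simple_transp_other)
  next
    case (2 x e)
    show ?case
    proof (cases "x = j \<or> x = Suc j")
      case True
      then show ?thesis using 2 fixd by auto
    next
      case False
      moreover have "x < ?s e \<and> ?s e < f x"
        using 2 False out[of x] by (cases "e = j \<or> e = Suc j") (auto simp: simple_transp_other)
      ultimately show ?thesis
        using 2 out[of x] goodD(2)[OF G, of x "?s e"] by (simp add: simple_transp_other)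
    qed
  next
    case (3 x y)
    consider "x \<noteq> j" "x \<noteq> Suc j" "y \<noteq> j" "y \<noteq> Suc j" | "x \<noteq> j" "x \<noteq> Suc j" "y = j \<or> y = Suc j"
      | "x = j \<or> x = Suc j" "y \<noteq> j" "y \<noteq> Suc j" | "x = j \<or> x = Suc j" "y = j \<or> y = Suc j" by blast
    then show ?case
    proof cases
      case 1
      then show ?thesis using 3 out[of x] out[of y] goodD(3)[OF G, of x y]
        by (simp add: simple_transp_other)
    next
      case 2
      then have "x < j" "f x < j" "b x = b j" using 3 out[of x] fixd b by auto
      then have "u x < u j" using 3 j goodD(3)[OF G, of x j] fixd 2 out[of x] by (auto simp: simple_transp_other)
      then show ?thesis using 2 lt fixd by auto
    next
      case c3: 3
      then have "Suc j < y" "Suc j < f y" "b y = b (Suc j)"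
        using 3 out[of y] fixd b by auto
      then have "u (Suc j) < u y \<and> u (Suc j) < u (f y)"
        using 3 j goodD(3)[OF G, of j y] goodD(3)[OF G, of "Suc j" y] fixd b c3 out[of y]
        by (auto simp: simple_transp_other)
      then show ?thesis using c3 lt by auto
    next
      case 4
      then show ?thesis using 3 fixd lt by auto
    qed
  qed
qed

text \<open>Given this, conjugating by \<open>s\<^sub>j\<close> changes no comparison on which \<open>good\<close> depends.\<close>

definition before :: "nat \<Rightarrow> (nat \<Rightarrow> nat) \<Rightarrow> (nat \<Rightarrow> nat) \<Rightarrow> bool" where
  "before j u f \<longleftrightarrow> u j < u (Suc j) \<and> u j < u (f (Suc j)) \<and> u (f j) < u (Suc j) \<and> u (f j) < u (f (Suc j))"

text \<open>Conjugation can reverse the order of two values only for j and j + 1, and the order of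
  their images only for f j and f (j + 1); \<open>before\<close> settles the clauses in which these
  pairs occur. One direction serves strict steps, the other their reversal.\<close>

lemma good_conj_same_block_iff:
  assumes S: "(b, f) \<in> states" and j: "j \<in> {1..<n}"
    and b: "b j = b (Suc j)" and asc: "f j < f (Suc j)" and nfix: "\<not> (f j = j \<and> f (Suc j) = Suc j)"
    and bef: "before j u f"
  shows "good n (u \<circ> simple_transp j) (b, simple_transp j \<circ> f \<circ> simple_transp j) \<longleftrightarrow> good n u (b, f)"
    (is "?L \<longleftrightarrow> ?R")
proof
  let ?s = "simple_transp j"
  note f = statesD[OF S]
  have f_eq: "f x = y \<longleftrightarrow> x = f y" for x y using f(2) by metis
  have neq: "f j \<noteq> Suc j" "f (Suc j) \<noteq> j" using asc f(2) by (metis not_less_iff_gr_or_eq lessI)+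
  have bs: "b (?s x) = b x" for x
    using b by (cases "x = j \<or> x = Suc j") (auto simp: simple_transp_other)
  have range: "?s x \<in> {1..n}" if "x \<in> {1..n}" for x
    using that permutes_in_image[OF simple_transp_permutes[OF j]] by blast
  have b1: "u j < u (Suc j)" "u j < u (f (Suc j))" "u (f j) < u (Suc j)" "u (f j) < u (f (Suc j))"
    using bef by (auto simp: before_def)
  have cyc: "?s x < ?s (f x) \<longleftrightarrow> x < f x" for x
    using neq neq[symmetric] by (auto simp: simple_transp_less_iff f_eq)
  {
    assume G: ?R
    show ?L
    proof (rule goodI, goal_cases)
      case (1 x)
      then show ?case using goodD(1)[OF G, of "?s x"] cyc[of "?s x"] by simp
    next
      case (2 x e)
      let ?x = "?s x" and ?e = "?s e"
      have *: "?s ?x < ?s ?e" "?s ?e < ?s (f ?x)" "u (f ?x) < u ?e" "u ?e < u ?x" using 2 by auto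
      \<comment> \<open>A value that is intermediate only after the conjugation stems from a
        reversed pair, and its position then contradicts \<open>before\<close>.\<close>
      then have "?x = Suc j \<and> ?e = j \<or> ?e = Suc j \<and> ?x = f j \<or> ?x < ?e \<and> ?e < f ?x"
        unfolding simple_transp_less_iff using f_eq[of ?x j] by blast
      then show False using * b1 goodD(2)[OF G, of ?x ?e] f(2) by auto
    next
      case (3 x y)
      let ?x = "?s x" and ?y = "?s y"
      have *: "?s ?x < ?s ?y" "?s (f ?x) < ?s (f ?y)" "b ?x = b ?y" "?x \<in> {1..n}" "?y \<in> {1..n}"
        using 3 bs range by auto
      \<comment> \<open>This reversal would require f to fix both j and j + 1.\<close>
      have key: "\<not> ?s (f (Suc j)) < ?s (f j)"
        using asc nfix by (auto simp: simple_transp_less_iff)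
      have "?x < ?y"
      proof (rule ccontr)
        assume "\<not> ?x < ?y"
        then have "?x = Suc j" "?y = j" using *(1) unfolding simple_transp_less_iff by blast+
        then show False using *(2) key by simp
      qed
      moreover have "f ?x < f ?y"
      proof (rule ccontr)
        assume "\<not> f ?x < f ?y"
        then have "f ?x = Suc j" "f ?y = j" using *(2) unfolding simple_transp_less_iff by blast+
        then have "?x = f (Suc j)" "?y = f j" using f(2) by metis+
        then show False using *(1) key by simp
      qed
      ultimately have "?x < ?y \<and> f ?x < f ?y" ..
      then show ?case using * goodD(3)[OF G, of ?x ?y] by simp
    qed
  next
    assume G: ?L
    show ?R
    proof (rule goodI, goal_cases)
      case (1 x)
      then show ?case using goodD(1)[OF G, of "?s x"] cyc[of "x"] by simp
    next
      case (2 x e)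
      then have "x = j \<and> e = Suc j \<or> e = j \<and> x = f (Suc j) \<or> ?s x < ?s e \<and> ?s e < ?s (f x)"
        by (auto simp: simple_transp_less_iff f_eq)
      then show False using 2 b1 goodD(2)[OF G, of "?s x" "?s e"] f(2) by auto
    next
      case (3 x y)
      then have "x = j \<and> y = Suc j \<or> x = f j \<and> y = f (Suc j) \<or> ?s x < ?s y \<and> ?s (f x) < ?s (f y)"
        by (auto simp: simple_transp_less_iff f_eq)
      then show ?case using 3 b1 bs range goodD(3)[OF G, of "?s x" "?s y"] f(2) by auto
    qed
  }
qed

text \<open>The clause on non-nested cycles, read once for (j, j + 1) and once for (f j, f (j + 1)),
  yields all four inequalities.\<close>

lemma good_before:
  assumes S: "(b, f) \<in> states" and j: "j \<in> {1..<n}"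
    and b: "b j = b (Suc j)" and asc: "f j < f (Suc j)" and G: "good n u (b, f)"
  shows "before j u f"
proof -
  note f = statesD[OF S]
  have "f j \<in> {1..n}" "f (Suc j) \<in> {1..n}" "j \<in> {1..n}" "Suc j \<in> {1..n}"
    using j permutes_in_image[OF f(1)] by auto
  then show ?thesis
    using goodD(3)[OF G, of j "Suc j"] goodD(3)[OF G, of "f j" "f (Suc j)"] asc b f
    by (simp add: before_def)
qed

text \<open>After conjugation the cycles through j and j + 1 either cross, and the clause on
  non-nested cycles separates them, or they are nested, the inner one possibly a fixed point, and
  the outer cycle admits no intermediate value. Either way \<open>before\<close> follows once u
  places j before j + 1.\<close>

lemma good_conj_before:
  assumes S: "(b, f) \<in> states" and j: "j \<in> {1..<n}" and u: "u permutes {1..n}"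
    and b: "b j = b (Suc j)" and asc: "f j < f (Suc j)" and nfix: "\<not> (f j = j \<and> f (Suc j) = Suc j)"
    and G: "good n (u \<circ> simple_transp j) (b, simple_transp j \<circ> f \<circ> simple_transp j)"
    and lt: "u j < u (Suc j)"
  shows "before j u f"
proof -
  let ?s = "simple_transp j" and ?c = "f j" and ?d = "f (Suc j)"
  note f = statesD[OF S]
  have neq: "?c \<noteq> Suc j" "?d \<noteq> j" using asc f(2) by (metis not_less_iff_gr_or_eq lessI)+
  have ne: "u x \<noteq> u y" if "x \<noteq> y" for x y using that permutes_inj[OF u] by (auto dest: injD)
  have range: "?c \<in> {1..n}" "?d \<in> {1..n}" using j permutes_in_image[OF f(1)] by auto
  have bcd: "b ?c = b ?d" "b ?c = b j" using f b by simp_all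
  have cne: "?c \<noteq> ?d" using asc by simp
  consider "?c < j" "?d > Suc j" | "?c < j" "?d < j" | "?c > Suc j" "?d > Suc j"
    | "?c = j" "?d > Suc j" | "?d = Suc j" "?c < j"
    using asc neq nfix by linarith
  then show ?thesis
  proof cases
    case 1
    have "u j < u ?c" using goodD(1)[OF G, of ?c] 1 f by (simp add: simple_transp_other)
    moreover have "u ?d < u (Suc j)" using goodD(1)[OF G, of j] 1 by (simp add: simple_transp_other)
    moreover have "u ?c < u ?d"
      using goodD(3)[OF G, of ?c j] 1 range j bcd f by (simp add: simple_transp_other)
    ultimately show ?thesis using lt by (simp add: before_def)
  next
    case 2
    have "u j < u ?c" using goodD(1)[OF G, of ?c] 2 f by (simp add: simple_transp_other)
    moreover have "u (Suc j) < u ?d" using goodD(1)[OF G, of ?d] 2 f by (simp add: simple_transp_other)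
    moreover have "\<not> (u j < u (Suc j) \<and> u (Suc j) < u ?c)"
      using goodD(2)[OF G, of ?c j] 2 f by (auto simp: simple_transp_other)
    ultimately show ?thesis using lt ne[of ?c "Suc j"] 2 by (auto simp: before_def)
  next
    case 3
    have "u ?c < u j" using goodD(1)[OF G, of "Suc j"] 3 by (simp add: simple_transp_other)
    moreover have "u ?d < u (Suc j)" using goodD(1)[OF G, of j] 3 by (simp add: simple_transp_other)
    moreover have "\<not> (u ?d < u j \<and> u j < u (Suc j))"
      using goodD(2)[OF G, of j "Suc j"] 3 by (auto simp: simple_transp_other)
    ultimately show ?thesis using lt ne[of ?d j] 3 neq by (auto simp: before_def)
  next
    case 4
    have "u ?d < u (Suc j)" using goodD(1)[OF G, of j] 4 by (simp add: simple_transp_other)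
    moreover have "\<not> (u ?d < u j \<and> u j < u (Suc j))"
      using goodD(2)[OF G, of j "Suc j"] 4 by (auto simp: simple_transp_other)
    ultimately show ?thesis using lt ne[of ?d j] 4 by (auto simp: before_def)
  next
    case 5
    have "u j < u ?c" using goodD(1)[OF G, of ?c] 5 f by (simp add: simple_transp_other)
    moreover have "\<not> (u j < u (Suc j) \<and> u (Suc j) < u ?c)"
      using goodD(2)[OF G, of ?c j] 5 f by (auto simp: simple_transp_other)
    ultimately show ?thesis using lt ne[of ?c "Suc j"] 5 by (auto simp: before_def)
  qed
qed

text \<open>Replacing w by s_j w turns \<open>inv w\<close> into
  \<open>inv w \<circ> simple_transp j\<close>. Strictness excludes the idle branch, and within a
  string b is invariant under s_j, so it stays compatible with the new positions.\<close>

lemma good_simple_step: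
  assumes S: "S \<in> states" and j: "j \<in> {1..<n}" and u: "u permutes {1..n}" and b: "fst S = blk \<circ> u"
    and G: "good n u S" and strict: "simple_step j S \<noteq> S"
  shows "good n (u \<circ> simple_transp j) (simple_step j S) \<and> fst (simple_step j S) = blk \<circ> (u \<circ> simple_transp j)"
proof -
  let ?s = "simple_transp j"
  obtain c f where Sf: "S = (c, f)" by (cases S)
  note S = S[unfolded Sf] and G = G[unfolded Sf]
  have c: "c = blk \<circ> u" using b Sf by simp
  have cs: "c \<circ> ?s = c" if "c j = c (Suc j)"
  proof
    fix x show "(c \<circ> ?s) x = c x"
      using that by (cases "x = j \<or> x = Suc j") (auto simp: simple_transp_other)
  qed
  consider "c j < c (Suc j)" | "c j = c (Suc j)" "f j \<le> f (Suc j)"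
  proof -
    have "\<not> (c (Suc j) < c j \<or> c j = c (Suc j) \<and> f (Suc j) < f j)"
      using strict by (auto simp: Sf simple_step_def)
    then show thesis using that by linarith
  qed
  then show ?thesis
  proof cases
    case 1
    then have "simple_step j S = (c \<circ> ?s, ?s \<circ> f \<circ> ?s)" by (simp add: Sf simple_step_def)
    then show ?thesis
      using good_conj_distinct_blocks[OF S j u c _ G] 1 c by (simp add: comp_assoc)
  next
    case 2
    have "f j \<noteq> f (Suc j)" using statesD(2)[OF S] by (metis n_not_Suc_n)
    with 2 have asc: "f j < f (Suc j)" by simp
    have ccs: "c = blk \<circ> (u \<circ> ?s)" using cs[OF 2(1)] c by (simp add: comp_assoc)
    show ?thesis
    proof (cases "f j = j \<and> f (Suc j) = Suc j")
      case True
      then have "simple_step j S = (c, ?s \<circ> f)" using 2 by (simp add: Sf simple_step_def)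
      then show ?thesis using good_left_mult[OF S j 2(1) _ _ G] True ccs by simp
    next
      case False
      then have "simple_step j S = (c, ?s \<circ> f \<circ> ?s)"
        using 2 asc cs[OF 2(1)] by (auto simp: Sf simple_step_def)
      moreover have "before j u f" using good_before[OF S j 2(1) asc G] .
      ultimately show ?thesis
        using good_conj_same_block_iff[OF S j 2(1) asc False] G ccs by (metis fst_conv)
    qed
  qed
qed

text \<open>Across distinct strings the values are relabelled back; a cycle of j and j + 1 is
  dissolved into two fixed points; otherwise f is conjugated back, where
  \<open>good_conj_before\<close> supplies the comparisons. In one string
  \<open>f j < f (Suc j)\<close> cannot occur, for \<open>good\<close> would then place j before j +
  1.\<close>

lemma good_predecessor:
  assumes S: "S \<in> states" and j: "j \<in> {1..<n}" and u: "u permutes {1..n}" and b: "fst S = blk \<circ> u"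
    and G: "good n u S" and desc: "u (Suc j) < u j"
  obtains S' where "S' \<in> states" "fst S' = blk \<circ> (u \<circ> simple_transp j)"
    "good n (u \<circ> simple_transp j) S'" "simple_step j S' = S" "S' \<noteq> S"
proof -
  let ?s = "simple_transp j"
  obtain c f where Sf: "S = (c, f)" by (cases S)
  note S = S[unfolded Sf] and G = G[unfolded Sf]
  have c: "c = blk \<circ> u" using b Sf by simp
  have cs: "c \<circ> ?s = c" if "c j = c (Suc j)"
  proof
    fix x show "(c \<circ> ?s) x = c x"
      using that by (cases "x = j \<or> x = Suc j") (auto simp: simple_transp_other)
  qed
  have us: "u \<circ> ?s permutes {1..n}"
    by (rule permutes_compose[OF simple_transp_permutes[OF j] u])
  have fj: "f j \<noteq> f (Suc j)" using statesD(2)[OF S] by (metis n_not_Suc_n)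
  have ffs: "?s \<circ> (?s \<circ> f \<circ> ?s) \<circ> ?s = f" by (simp add: fun_eq_iff)
  show thesis
  proof (cases "c j = c (Suc j)")
    case False
    have "u j \<in> {1..n}" "u (Suc j) \<in> {1..n}"
      using j permutes_in_image[OF u] by auto
    \<comment> \<open>The value j + 1 stands before j, so its string is not later; this orients the
      two strings so that the step from the relabelled state is strict.\<close>
    then have "c (Suc j) \<le> c j" using blk_mono desc c by simp
    with False have lt: "c (Suc j) < c j" by simp
    show thesis
    proof (rule that)
      show "(c \<circ> ?s, ?s \<circ> f \<circ> ?s) \<in> states" by (rule conj_states[OF S j])
      show "good n (u \<circ> ?s) (c \<circ> ?s, ?s \<circ> f \<circ> ?s)"
        by (rule good_conj_distinct_blocks[OF S j u c False G])
      show "simple_step j (c \<circ> ?s, ?s \<circ> f \<circ> ?s) = S"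
        using lt ffs by (simp add: simple_step_def Sf)
      have "(c \<circ> ?s) j \<noteq> c j" using lt by simp
      then show "(c \<circ> ?s, ?s \<circ> f \<circ> ?s) \<noteq> S" unfolding Sf by (metis fst_conv)
    qed (simp add: c comp_assoc)
  next
    case True
    have "\<not> f j < f (Suc j)"
      using good_before[OF S j True _ G] desc by (auto simp: before_def)
    then have lt: "f (Suc j) < f j" using fj by simp
    have ccs: "c = blk \<circ> (u \<circ> ?s)" using cs[OF True] c by (simp add: comp_assoc)
    show thesis
    proof (cases "f j = Suc j")
      case swap: True
      then have swap': "f (Suc j) = j" using statesD(2)[OF S, of j] by simp
      have comm: "?s \<circ> f = f \<circ> ?s"
      proof
        fix x
        have "x = j \<or> x = Suc j \<or> (x \<noteq> j \<and> x \<noteq> Suc j \<and> f x \<noteq> j \<and> f x \<noteq> Suc j)"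
          using swap swap' statesD(2)[OF S] by metis
        then show "(?s \<circ> f) x = (f \<circ> ?s) x"
          using swap swap' by (auto simp: simple_transp_other)
      qed
      have S': "(c, ?s \<circ> f) \<in> states" by (rule left_mult_states[OF S j True comm])
      have fixd: "(?s \<circ> f) j = j" "(?s \<circ> f) (Suc j) = Suc j" using swap swap' by simp_all
      show thesis
      proof (rule that[OF S'])
        show "good n (u \<circ> ?s) (c, ?s \<circ> f)"
        proof (rule good_left_mult_converse[OF S' j True fixd])
          show "good n (u \<circ> ?s \<circ> ?s) (c, ?s \<circ> (?s \<circ> f))"
            using G unfolding simple_transp_comp_self .
        qed
        show "simple_step j (c, ?s \<circ> f) = S"
          using fixd True by (simp add: simple_step_def Sf)
        have "(?s \<circ> f) j \<noteq> f j" using swap by simp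
        then show "(c, ?s \<circ> f) \<noteq> S" unfolding Sf by (metis snd_conv)
      qed (use ccs in simp)
    next
      case nswap: False
      let ?f = "?s \<circ> f \<circ> ?s"
      have S': "(c, ?f) \<in> states" using conj_states[OF S j] cs[OF True] by simp
      have asc: "?f j < ?f (Suc j)"
        using lt nswap by (auto simp: simple_transp_less_iff)
      have nfix: "\<not> (?f j = j \<and> ?f (Suc j) = Suc j)"
      proof
        assume "?f j = j \<and> ?f (Suc j) = Suc j"
        then have "?s (?s (f (Suc j))) = ?s j" "?s (?s (f j)) = ?s (Suc j)" by simp_all
        then show False using lt by simp
      qed
      have G': "good n (u \<circ> ?s \<circ> ?s) (c, ?s \<circ> ?f \<circ> ?s)" using G ffs by simp
      have "before j (u \<circ> ?s) ?f"
        by (rule good_conj_before[OF S' j us True asc nfix G']) (use desc in simp)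
      then have good': "good n (u \<circ> ?s) (c, ?f)"
        using good_conj_same_block_iff[OF S' j True asc nfix] G' by blast
      show thesis
      proof (rule that[OF S' _ good'])
        show "simple_step j (c, ?f) = S"
          using asc nfix True cs[OF True] ffs by (auto simp: simple_step_def Sf)
        show "(c, ?f) \<noteq> S" using asc lt unfolding Sf by (metis order_less_asym snd_conv)
      qed (use ccs in simp)
    qed
  qed
qed

section \<open>The rank function on states\<close>

text \<open>For a state these are the pairs of values out of order in the one-line notation it
  encodes, so their number is the length of that permutation.\<close>

definition inversions :: "(nat \<Rightarrow> nat) \<Rightarrow> (nat \<Rightarrow> nat) \<Rightarrow> (nat \<times> nat) set" where
  "inversions b f = {(x, y). x \<in> {1..n} \<and> y \<in> {1..n} \<and> x < y \<and> (b y < b x \<or> b x = b y \<and> f y < f x)}"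

definition block_inversions :: "(nat \<Rightarrow> nat) \<Rightarrow> (nat \<times> nat) set" where
  "block_inversions b = {(x, y). x \<in> {1..n} \<and> y \<in> {1..n} \<and> x < y \<and> b y < b x}"

definition excedances :: "(nat \<Rightarrow> nat) \<Rightarrow> nat set" where
  "excedances f = {x \<in> {1..n}. x < f x}"

text \<open>
  For a single block this is the classical rank \<open>(\<ell>(f) + #2-cycles) / 2\<close> of an involution; a change
  of block adds an inversion of both of the first two kinds.
\<close>

definition rk :: "(nat \<Rightarrow> nat) \<times> (nat \<Rightarrow> nat) \<Rightarrow> nat" where
  "rk S = (case S of (b, f) \<Rightarrow>
     (card (inversions b f) + card (block_inversions b) + card (excedances f)) div 2)"

lemma finite_rk_sets: "finite (inversions b f)" "finite (block_inversions b)" "finite (excedances f)"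
proof -
  show "finite (inversions b f)" "finite (block_inversions b)"
    by (rule finite_subset[of _ "{1..n} \<times> {1..n}"]; auto simp: inversions_def block_inversions_def)+
qed (simp add: excedances_def)

lemma card_simple_transp_pairs: "card {(x, y). (simple_transp j x, simple_transp j y) \<in> I} = card I"
proof -
  have "{(x, y). (simple_transp j x, simple_transp j y) \<in> I} = map_prod (simple_transp j) (simple_transp j) ` I"
    by (force simp: image_iff)
  moreover have "inj_on (map_prod (simple_transp j) (simple_transp j)) I"
    by (auto simp: inj_on_def)
  ultimately show ?thesis by (simp add: card_image)
qed

lemma finite_simple_transp_pairs:
  "finite I \<Longrightarrow> finite {(x, y). (simple_transp j x, simple_transp j y) \<in> I}"
proof -
  have "{(x, y). (simple_transp j x, simple_transp j y) \<in> I} = map_prod (simple_transp j) (simple_transp j) ` I"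
    by (force simp: image_iff)
  then show "finite I \<Longrightarrow> ?thesis" by simp
qed

text \<open>s_j can exchange the smaller and the larger end of a 2-cycle only when the cycle
  consists of j and j + 1, which the hypothesis excludes.\<close>

lemma card_excedances_conj:
  assumes j: "j \<in> {1..<n}" and neq: "f j \<noteq> Suc j" and f: "\<And>x. f (f x) = x"
  shows "card (excedances (simple_transp j \<circ> f \<circ> simple_transp j)) = card (excedances f)"
proof -
  let ?s = "simple_transp j"
  have range: "?s x \<in> {1..n} \<longleftrightarrow> x \<in> {1..n}" for x
    using permutes_in_image[OF simple_transp_permutes[OF j]] .
  have f_eq: "f x = y \<longleftrightarrow> x = f y" for x y using f by metis
  have cyc: "?s x < ?s (f x) \<longleftrightarrow> x < f x" for x
    using neq neq[symmetric] f by (auto simp: simple_transp_less_iff f_eq)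
  have "excedances (?s \<circ> f \<circ> ?s) = ?s ` excedances f"
  proof (intro set_eqI iffI)
    fix x assume "x \<in> excedances (?s \<circ> f \<circ> ?s)"
    then have "?s x \<in> excedances f"
      using cyc[of "?s x"] range by (simp add: excedances_def)
    then have "?s (?s x) \<in> ?s ` excedances f" by blast
    then show "x \<in> ?s ` excedances f" by simp
  next
    fix x assume "x \<in> ?s ` excedances f"
    then show "x \<in> excedances (?s \<circ> f \<circ> ?s)"
      using cyc range by (auto simp: excedances_def)
  qed
  moreover have "inj_on ?s (excedances f)" by (auto simp: inj_on_def)
  ultimately show ?thesis by (simp add: card_image)
qed

text \<open>The numerator of \<open>rk\<close> grows by exactly two, so its half grows by one
  whatever the parity: across strings by one inversion of either kind, for a new 2-cycle by an
  inversion and an excedance, for a conjugation inside a string by two inversions.\<close>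

lemma rk_simple_step:
  assumes S: "S \<in> states" and j: "j \<in> {1..<n}" and strict: "simple_step j S \<noteq> S"
  shows "rk (simple_step j S) = Suc (rk S)"
proof -
  let ?s = "simple_transp j"
  obtain b f where Sf: "S = (b, f)" by (cases S)
  note S = S[unfolded Sf]
  note f = statesD[OF S]
  have f_eq: "f x = y \<longleftrightarrow> x = f y" for x y using f(2) by metis
  have range: "?s x \<in> {1..n} \<longleftrightarrow> x \<in> {1..n}" for x
    using permutes_in_image[OF simple_transp_permutes[OF j]] .
  have jn: "j \<in> {1..n}" "Suc j \<in> {1..n}" using j by auto
  have fj: "f j \<noteq> f (Suc j)" using f(2) by (metis n_not_Suc_n)
  consider (blocks) "b j < b (Suc j)" | (fixed) "b j = b (Suc j)" "f j = j" "f (Suc j) = Suc j"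
    | (conj) "b j = b (Suc j)" "f j < f (Suc j)" "\<not> (f j = j \<and> f (Suc j) = Suc j)"
  proof -
    have "\<not> (b (Suc j) < b j \<or> b j = b (Suc j) \<and> f (Suc j) < f j)"
      using strict by (auto simp: Sf simple_step_def)
    then show thesis using that fj by linarith
  qed
  then show ?thesis
  proof cases
    case blocks
    let ?b = "b \<circ> ?s" and ?f = "?s \<circ> f \<circ> ?s"
    have step: "simple_step j S = (?b, ?f)" using blocks by (simp add: Sf simple_step_def)
    have ord: "?s x < ?s y \<longleftrightarrow> x < y" if "b x = b y" for x y
      using that blocks by (auto simp: simple_transp_less_iff)
    have lt: "?s x < ?s y \<longleftrightarrow> x < y" if "b (?s y) < b (?s x)" "(x, y) \<noteq> (j, Suc j)" for x y
      using that blocks by (auto simp: simple_transp_less_iff)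
    have "block_inversions ?b = insert (j, Suc j) {(x, y). (?s x, ?s y) \<in> block_inversions b}"
      using lt range jn blocks by (auto simp: block_inversions_def simp del: One_nat_def)
    moreover have "(j, Suc j) \<notin> {(x, y). (?s x, ?s y) \<in> block_inversions b}"
      by (simp add: block_inversions_def)
    ultimately have V: "card (block_inversions ?b) = Suc (card (block_inversions b))"
      by (simp add: finite_simple_transp_pairs finite_rk_sets card_simple_transp_pairs)
    have "inversions ?b ?f = insert (j, Suc j) {(x, y). (?s x, ?s y) \<in> inversions b f}"
    proof -
      have "(x, y) \<in> inversions ?b ?f \<longleftrightarrow> (x, y) = (j, Suc j) \<or> (?s x, ?s y) \<in> inversions b f" for x y
      proof (cases "b (?s x) = b (?s y)")
        case True
        then have "(x, y) \<noteq> (j, Suc j)" using blocks by auto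
        moreover have "x < y \<longleftrightarrow> ?s x < ?s y" using ord[OF True] by simp
        moreover have "?s (f (?s y)) < ?s (f (?s x)) \<longleftrightarrow> f (?s y) < f (?s x)"
          using True f(3) by (intro ord) simp
        ultimately show ?thesis using True range[of x] range[of y] by (auto simp: inversions_def)
      next
        case False
        then show ?thesis
          using lt range jn blocks by (auto simp: inversions_def simp del: One_nat_def)
      qed
      then show ?thesis by auto
    qed
    moreover have "(j, Suc j) \<notin> {(x, y). (?s x, ?s y) \<in> inversions b f}"
      by (simp add: inversions_def)
    ultimately have I: "card (inversions ?b ?f) = Suc (card (inversions b f))"
      by (simp add: finite_simple_transp_pairs finite_rk_sets card_simple_transp_pairs)
    have "f j \<noteq> Suc j" using blocks f(3)[of j] by auto
    then have "card (excedances ?f) = card (excedances f)"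
      using card_excedances_conj[OF j _ f(2)] by simp
    with V I show ?thesis unfolding step unfolding Sf rk_def by simp
  next
    case fixed
    let ?f = "?s \<circ> f"
    have step: "simple_step j S = (b, ?f)" using fixed by (simp add: Sf simple_step_def)
    have "inversions b ?f = insert (j, Suc j) (inversions b f)"
    proof -
      have "(x, y) \<in> inversions b ?f \<longleftrightarrow> (x, y) = (j, Suc j) \<or> (x, y) \<in> inversions b f" for x y
      proof (cases "x = j \<and> y = Suc j \<or> x = Suc j \<and> y = j")
        case True
        then show ?thesis using fixed jn by (auto simp: inversions_def)
      next
        case False
        have "f y = Suc j \<longleftrightarrow> y = Suc j" "f x = Suc j \<longleftrightarrow> x = Suc j" "f y = j \<longleftrightarrow> y = j" "f x = j \<longleftrightarrow> x = j"
          using fixed f(2) by metis+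
        then have "?s (f y) < ?s (f x) \<longleftrightarrow> f y < f x"
          using False by (auto simp: simple_transp_less_iff)
        then show ?thesis using False by (auto simp: inversions_def)
      qed
      then show ?thesis by auto
    qed
    moreover have "(j, Suc j) \<notin> inversions b f" using fixed by (simp add: inversions_def)
    ultimately have I: "card (inversions b ?f) = Suc (card (inversions b f))"
      by (simp add: finite_rk_sets)
    have "x < ?s (f x) \<longleftrightarrow> x = j \<or> x < f x" for x
    proof (cases "x = j \<or> x = Suc j")
      case False
      then have "f x \<noteq> j" "f x \<noteq> Suc j" using fixed f(2) by metis+
      with False show ?thesis by (simp add: simple_transp_other)
    qed (use fixed in auto)
    then have "excedances ?f = insert j (excedances f)" using jn by (auto simp: excedances_def)
    moreover have "j \<notin> excedances f" using fixed by (simp add: excedances_def)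
    ultimately have "card (excedances ?f) = Suc (card (excedances f))" by (simp add: finite_rk_sets)
    with I show ?thesis unfolding step unfolding Sf rk_def by simp
  next
    case conj
    let ?f = "?s \<circ> f \<circ> ?s" and ?c = "?s (f j)" and ?d = "?s (f (Suc j))"
    have bs: "b (?s x) = b x" for x
      using conj by (cases "x = j \<or> x = Suc j") (auto simp: simple_transp_other)
    then have step: "simple_step j S = (b, ?f)"
      using conj by (auto simp: Sf simple_step_def fun_eq_iff)
    have neq: "f j \<noteq> Suc j" using conj(2) f(2) by (metis not_less_iff_gr_or_eq lessI)
    have "?c < ?d" using conj by (auto simp: simple_transp_less_iff)
    moreover have "?c \<in> {1..n}" "?d \<in> {1..n}"
      using range permutes_in_image[OF f(1)] jn by blast+
    moreover have "b ?c = b ?d" using conj bs f(3) by simp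
    ultimately have cd: "?c < ?d" "?c \<in> {1..n}" "?d \<in> {1..n}" "b ?c = b ?d" .
    \<comment> \<open>The second new inversion is formed by the images of j + 1 and j under the
      conjugated involution.\<close>
    have "inversions b ?f =
        insert (j, Suc j) (insert (?c, ?d) {(x, y). (?s x, ?s y) \<in> inversions b f})"
    proof -
      have "(x, y) \<in> inversions b ?f \<longleftrightarrow> (x, y) = (j, Suc j) \<or> (x, y) = (?c, ?d) \<or> (?s x, ?s y) \<in> inversions b f"
        for x y
      proof -
        consider "(x, y) = (j, Suc j)" | "(x, y) = (Suc j, j)" | "(x, y) = (?c, ?d)" | "(x, y) = (?d, ?c)"
          | "(x, y) \<noteq> (j, Suc j)" "(x, y) \<noteq> (Suc j, j)" "(x, y) \<noteq> (?c, ?d)" "(x, y) \<noteq> (?d, ?c)" by blast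
        then show ?thesis
        proof cases
          case 1
          have "(j, Suc j) \<in> inversions b ?f" using cd(1) jn conj(1) by (simp add: inversions_def)
          then show ?thesis using 1 by simp
        next
          case 2
          have "(Suc j, j) \<notin> inversions b ?f" "(j, Suc j) \<notin> inversions b f" "(Suc j, j) \<noteq> (?c, ?d)"
            using cd(1) conj(1,2) by (auto simp: inversions_def)
          then show ?thesis using 2 by simp
        next
          case 3
          have "(?c, ?d) \<in> inversions b ?f" using cd f(2) by (simp add: inversions_def)
          then show ?thesis using 3 by simp
        next
          case 4
          have "(?d, ?c) \<notin> inversions b ?f" "(f (Suc j), f j) \<notin> inversions b f"
            "(?d, ?c) \<noteq> (j, Suc j)" "(?d, ?c) \<noteq> (?c, ?d)"
            using cd(1) conj(2) by (auto simp: inversions_def)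
          then show ?thesis using 4 by simp
        next
          case 5
          have lt: "x < y \<longleftrightarrow> ?s x < ?s y" unfolding simple_transp_less_iff using 5 by blast
          have sw: "f (?s z) = j \<longleftrightarrow> z = ?c" "f (?s z) = Suc j \<longleftrightarrow> z = ?d" for z
            using f(2) simple_transp_involutory by metis+
          have "?s (f (?s y)) < ?s (f (?s x)) \<longleftrightarrow> f (?s y) < f (?s x)"
            unfolding simple_transp_less_iff using 5 sw by blast
          then show ?thesis using 5 lt bs range[of x] range[of y]
            unfolding inversions_def mem_Collect_eq prod.case comp_apply by metis
        qed
      qed
      then show ?thesis by auto
    qed
    \<comment> \<open>The two new pairs could coincide only if f j = j + 1.\<close>
    moreover have "(j, Suc j) \<notin> insert (?c, ?d) {(x, y). (?s x, ?s y) \<in> inversions b f}"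
    proof
      assume "(j, Suc j) \<in> insert (?c, ?d) {(x, y). (?s x, ?s y) \<in> inversions b f}"
      then have "?s j = ?s ?c" "?s (Suc j) = ?s ?d" by (auto simp: inversions_def)
      then show False using neq by simp
    qed
    moreover have "(?c, ?d) \<notin> {(x, y). (?s x, ?s y) \<in> inversions b f}"
      using conj f by (auto simp: inversions_def)
    ultimately have I: "card (inversions b ?f) = Suc (Suc (card (inversions b f)))"
      by (simp add: finite_simple_transp_pairs finite_rk_sets card_simple_transp_pairs)
    have "card (excedances ?f) = card (excedances f)"
      using card_excedances_conj[OF j neq f(2)] .
    with I show ?thesis unfolding step unfolding Sf rk_def by simp
  qed
qed

section \<open>Words acting on the initial state\<close>

definition initial :: "(nat \<Rightarrow> nat) \<times> (nat \<Rightarrow> nat)" where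
  "initial = (blk, id)"

lemma initial_states: "initial \<in> states"
  using permutes_id[of "{1..n}"] by (auto simp: initial_def states_def intro!: exI[of _ id])

lemma rk_initial: "rk initial = 0"
proof -
  have "inversions blk id = {}" "block_inversions blk = {}" "excedances id = {}"
    using blk_mono by (force simp: inversions_def block_inversions_def excedances_def not_less)+
  then show ?thesis by (simp add: rk_def initial_def)
qed

definition word_step :: "nat list \<Rightarrow> (nat \<Rightarrow> nat) \<times> (nat \<Rightarrow> nat) \<Rightarrow> (nat \<Rightarrow> nat) \<times> (nat \<Rightarrow> nat)" where
  "word_step js S = foldr simple_step js S"

lemma word_step_simps [simp]:
  "word_step [] S = S" "word_step (j # js) S = simple_step j (word_step js S)"
  "word_step (js @ ks) S = word_step js (word_step ks S)"
  by (simp_all add: word_step_def)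

lemma word_step_states: "S \<in> states \<Longrightarrow> set js \<subseteq> {1..<n} \<Longrightarrow> word_step js S \<in> states"
  by (induction js) (auto intro!: simple_step_states)

lemma rk_simple_step_le:
  "S \<in> states \<Longrightarrow> j \<in> {1..<n} \<Longrightarrow> rk (simple_step j S) \<le> Suc (rk S)"
  by (cases "simple_step j S = S") (simp_all add: rk_simple_step)

lemma rk_word_step_le:
  "S \<in> states \<Longrightarrow> set js \<subseteq> {1..<n} \<Longrightarrow> rk (word_step js S) \<le> length js + rk S"
proof (induction js)
  case (Cons j js)
  then show ?case
    using rk_simple_step_le[of "word_step js S" j] word_step_states[of S js] by simp
qed simp

text \<open>Letters that leave the state unchanged are dropped; each remaining one raises the rank
  by one.\<close>

lemma word_step_strict_subword:
  assumes "S \<in> states" "set js \<subseteq> {1..<n}"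
  obtains ks where "set ks \<subseteq> {1..<n}" "word_step ks S = word_step js S"
    "rk (word_step ks S) = length ks + rk S"
proof -
  have "\<exists>ks. set ks \<subseteq> {1..<n} \<and> word_step ks S = word_step js S \<and> rk (word_step ks S) = length ks + rk S"
    using assms(2)
  proof (induction js)
    case Nil
    show ?case by (rule exI[of _ "[]"]) simp
  next
    case (Cons j js)
    then obtain ks where ks: "set ks \<subseteq> {1..<n}" "word_step ks S = word_step js S"
      "rk (word_step ks S) = length ks + rk S" by auto
    show ?case
    proof (cases "simple_step j (word_step ks S) = word_step ks S")
      case True
      then show ?thesis using ks by (intro exI[of _ ks]) simp
    next
      case False
      then show ?thesis
        using ks Cons.prems rk_simple_step[OF word_step_states[OF assms(1) ks(1)], of j]
        by (intro exI[of _ "j # ks"]) simp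
    qed
  qed
  then show thesis using that by blast
qed

text \<open>A letter raises the rank by at most one, so a rank equal to the number of letters means
  that every letter acts strictly, and \<open>good_simple_step\<close> applies throughout.\<close>

lemma good_word_step:
  assumes "set js \<subseteq> {1..<n}" "rk (word_step js initial) = length js"
  shows "good n (inv (word_perm js)) (word_step js initial) \<and>
    fst (word_step js initial) = blk \<circ> inv (word_perm js)"
  using assms
proof (induction js)
  case Nil
  show ?case by (auto simp: good_def initial_def inv_id)
next
  case (Cons j js)
  let ?S = "word_step js initial"
  have j: "j \<in> {1..<n}" and js: "set js \<subseteq> {1..<n}" using Cons.prems by auto
  note st = word_step_states[OF initial_states js]
  have "rk ?S \<le> length js" using rk_word_step_le[OF initial_states js] rk_initial by simp
  moreover have "rk (simple_step j ?S) = Suc (length js)" using Cons.prems by simp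
  ultimately have "rk ?S = length js" and strict: "simple_step j ?S \<noteq> ?S"
    using rk_simple_step_le[OF st j] by auto
  then have IH: "good n (inv (word_perm js)) ?S" "fst ?S = blk \<circ> inv (word_perm js)"
    using Cons.IH js by blast+
  show ?case
    using good_simple_step[OF st j permutes_inv[OF word_perm_permutes[OF js]] IH(2,1) strict]
    unfolding word_perm_simps word_step_simps inv_simple_transp_comp[OF word_perm_permutes[OF js]] .
qed

text \<open>With u the identity \<open>good\<close> forbids excedances, and an involution with
  \<open>f x \<le> x\<close> everywhere is the identity.\<close>

lemma good_initial_unique:
  assumes "S \<in> states" "fst S = blk" "good n id S"
  shows "S = initial"
proof -
  obtain b f where Sf: "S = (b, f)" by (cases S)
  have le: "f x \<le> x" for x
    using goodD(1)[OF assms(3)[unfolded Sf], of x] by force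
  have "f x = x" for x
    using le[of x] le[of "f x"] statesD(2)[OF assms(1)[unfolded Sf], of x] by simp
  then show ?thesis using Sf assms(2) by (auto simp: initial_def)
qed

text \<open>The first letter is a left descent and is undone by \<open>good_predecessor\<close>. The
  reduced word is arbitrary, which is how independence of the choice in \<open>perm_act\<close> is
  obtained.\<close>

lemma word_step_reduced:
  assumes "reduced_expression n js w" "w permutes {1..n}" "S \<in> states" "fst S = blk \<circ> inv w" "good n (inv w) S"
  shows "word_step js initial = S \<and> rk S = length js"
  using assms
proof (induction js arbitrary: w S)
  case Nil
  have "w = id" using Nil.prems(1) by (simp add: reduced_expression_Nil_iff)
  then have "S = initial"
    using good_initial_unique[OF Nil.prems(3)] Nil.prems(4,5) by (metis comp_id inv_id)
  then show ?case using rk_initial by simp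
next
  case (Cons j js)
  note red = reduced_expression_ConsD[OF Cons.prems(1)]
  have inv: "inv (simple_transp j \<circ> w) = inv w \<circ> simple_transp j"
    by (rule inv_simple_transp_comp[OF Cons.prems(2)])
  obtain S' where S': "S' \<in> states" "fst S' = blk \<circ> (inv w \<circ> simple_transp j)"
    "good n (inv w \<circ> simple_transp j) S'" "simple_step j S' = S" "S' \<noteq> S"
    by (rule good_predecessor[OF Cons.prems(3) red(1) permutes_inv[OF Cons.prems(2)] Cons.prems(4,5) red(2)])
  then have "word_step js initial = S' \<and> rk S' = length js"
    using Cons.IH[OF red(3) simple_transp_comp_permutes[OF Cons.prems(2) red(1)] S'(1)]
    unfolding inv by blast
  then show ?case using S' rk_simple_step[OF S'(1) red(1)] by simp
qed

section \<open>Reachability between states\<close>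

text \<open>Arbitrary words make transitivity a matter of concatenation, whereas
  \<open>rev_weak_le\<close> quantifies over permutations acting through a chosen word.\<close>

definition reaches :: "(nat \<Rightarrow> nat) \<times> (nat \<Rightarrow> nat) \<Rightarrow> (nat \<Rightarrow> nat) \<times> (nat \<Rightarrow> nat) \<Rightarrow> bool" where
  "reaches S S' \<longleftrightarrow> (\<exists>js. set js \<subseteq> {1..<n} \<and> S' = word_step js S)"

lemma reaches_refl: "reaches S S"
  unfolding reaches_def by (rule exI[of _ "[]"]) simp

lemma reaches_trans: "reaches S S' \<Longrightarrow> reaches S' S'' \<Longrightarrow> reaches S S''"
  unfolding reaches_def by (metis le_sup_iff set_append word_step_simps(3))

lemma reaches_states: "reaches S S' \<Longrightarrow> S \<in> states \<Longrightarrow> S' \<in> states"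
  using word_step_states unfolding reaches_def by blast

lemma rk_reaches_less:
  assumes "S \<in> states" "reaches S S'" "S \<noteq> S'"
  shows "rk S < rk S'"
proof -
  obtain ks where "S' = word_step ks S" "rk S' = length ks + rk S"
    using assms word_step_strict_subword unfolding reaches_def by metis
  then show ?thesis using assms(3) by (cases ks) auto
qed

lemma reaches_intermediate:
  assumes "S \<in> states" "reaches S S'" "S \<noteq> S'"
  obtains S'' where "reaches S S''" "reaches S'' S'" "rk S'' = Suc (rk S)"
proof -
  obtain ks where ks: "set ks \<subseteq> {1..<n}" "S' = word_step ks S" "rk S' = length ks + rk S"
    using assms word_step_strict_subword unfolding reaches_def by metis
  then have "ks \<noteq> []" using assms(3) by auto
  then obtain ls j where ls: "ks = ls @ [j]" by (metis rev_exhaust)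
  then have j: "j \<in> {1..<n}" and l: "set ls \<subseteq> {1..<n}" using ks by auto
  let ?T = "simple_step j S"
  have "reaches S ?T" unfolding reaches_def by (rule exI[of _ "[j]"]) (use j in simp)
  moreover have "reaches ?T S'" unfolding reaches_def using l ls ks by auto
  moreover have "rk ?T = Suc (rk S)"
  proof -
    \<comment> \<open>The total gain in rank equals the length of the word, so its rightmost letter
      must contribute one.\<close>
    have "rk S' \<le> length ls + rk ?T"
      using rk_word_step_le[OF simple_step_states[OF assms(1) j] l] ks ls by simp
    then show ?thesis using rk_simple_step_le[OF assms(1) j] ks ls by simp
  qed
  ultimately show thesis by (rule that)
qed

text \<open>
  A strict word from the initial state through \<open>S\<close> is reduced, and every reduced word of its
  permutation ends in the same state; hence so does the word in which the part after \<open>S\<close>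
  is exchanged for another reduced one.
\<close>

lemma reaches_reduced:
  assumes S: "reaches initial S" and S': "reaches S S'"
  obtains w where "w permutes {1..n}" "\<And>js. reduced_expression n js w \<Longrightarrow> word_step js S = S'"
proof -
  have st: "S \<in> states" using reaches_states[OF S initial_states] .
  obtain ks where ks: "set ks \<subseteq> {1..<n}" "S = word_step ks initial" "rk S = length ks"
    using S word_step_strict_subword[OF initial_states] rk_initial unfolding reaches_def by (metis add_0_right)
  obtain ls where ls: "set ls \<subseteq> {1..<n}" "S' = word_step ls S" "rk S' = length ls + rk S"
    using S' word_step_strict_subword[OF st] unfolding reaches_def by metis
  let ?w = "word_perm (ls @ ks)"
  have lsks: "set (ls @ ks) \<subseteq> {1..<n}" "S' = word_step (ls @ ks) initial"
    "rk (word_step (ls @ ks) initial) = length (ls @ ks)"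
    using ks ls by auto
  have w: "?w permutes {1..n}" by (rule word_perm_permutes[OF lsks(1)])
  have good: "good n (inv ?w) S'" "fst S' = blk \<circ> inv ?w"
    using good_word_step[OF lsks(1,3)] lsks(2) by auto
  have st': "S' \<in> states" using reaches_states[OF S' st] .
  obtain ms where "reduced_expression n ms ?w" using reduced_expression_exists[OF w] by blast
  then have len: "perm_length n ?w = length (ls @ ks)"
    using word_step_reduced[OF _ w st' good(2,1)] ks ls by (auto simp: reduced_expression_iff)
  show thesis
  proof (rule that[of "word_perm ls"])
    show "word_perm ls permutes {1..n}" by (rule word_perm_permutes[OF ls(1)])
    fix js assume js: "reduced_expression n js (word_perm ls)"
    then have "set (js @ ks) \<subseteq> {1..<n}" "word_perm (js @ ks) = ?w" "length js \<le> length ls"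
      using ks(1) perm_length_word_le[OF ls(1)] by (auto simp: reduced_expression_iff word_perm_append)
    \<comment> \<open>As a reduced word js is no longer than ls, while no word for \<open>?w\<close>
      is shorter than \<open>ls @ ks\<close>; so the exchanged word has exactly the required
      length.\<close>
    then have "reduced_expression n (js @ ks) ?w"
      using len perm_length_word_le[of "js @ ks" n] by (auto simp: reduced_expression_iff)
    from word_step_reduced[OF this w st' good(2,1)] show "word_step js S = S'"
      using ks by simp
  qed
qed

end

subsection \<open>Maximal chains and strings\<close>

lemma maxchainD:
  assumes "pred_on.maxchain A le C"
  shows "C \<subseteq> A" "\<And>x y. x \<in> C \<Longrightarrow> y \<in> C \<Longrightarrow> x = y \<or> le x y \<or> le y x"
    "\<And>z. z \<in> A \<Longrightarrow> (\<And>x. x \<in> C \<Longrightarrow> x = z \<or> le x z \<or> le z x) \<Longrightarrow> z \<in> C"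
proof -
  have C: "pred_on.chain A le C"
    using assms by (rule pred_on.maxchain_imp_chain)
  then show sub: "C \<subseteq> A" and cmp: "\<And>x y. x \<in> C \<Longrightarrow> y \<in> C \<Longrightarrow> x = y \<or> le x y \<or> le y x"
    by (auto simp: pred_on.chain_def)
  fix z assume z: "z \<in> A" "\<And>x. x \<in> C \<Longrightarrow> x = z \<or> le x z \<or> le z x"
  then have "pred_on.chain A le (insert z C)"
    using sub cmp by (auto simp: pred_on.chain_def)
  then show "z \<in> C"
    using assms by (auto simp: pred_on.maxchain_def)
qed

text \<open>No rank is skipped: an element one rank above x and below the next element of the chain
  is comparable with the whole chain, hence belongs to it by maximality. Ranks are distinct along a
  chain, so counting ranks counts elements.\<close>

lemma card_maxchain_graded:
  fixes \<rho> :: "'a \<Rightarrow> nat"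
  assumes trans: "\<And>x y z. x \<in> A \<Longrightarrow> y \<in> A \<Longrightarrow> z \<in> A \<Longrightarrow> le x y \<Longrightarrow> le y z \<Longrightarrow> le x z"
    and less: "\<And>x y. x \<in> A \<Longrightarrow> y \<in> A \<Longrightarrow> le x y \<Longrightarrow> x \<noteq> y \<Longrightarrow> \<rho> x < \<rho> y"
    and between: "\<And>x y. x \<in> A \<Longrightarrow> y \<in> A \<Longrightarrow> le x y \<Longrightarrow> x \<noteq> y \<Longrightarrow>
      \<exists>z\<in>A. le x z \<and> le z y \<and> \<rho> z = Suc (\<rho> x)"
    and bot: "b \<in> A" "\<And>x. x \<in> A \<Longrightarrow> le b x" "\<rho> b = 0"
    and top: "t \<in> A" "\<And>x. x \<in> A \<Longrightarrow> le x t"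
    and C: "pred_on.maxchain A le C"
  shows "card C = Suc (\<rho> t)"
proof -
  note C = maxchainD[OF C]
  have mem: "x \<in> A" if "x \<in> C" for x using that C(1) by blast
  have bC: "b \<in> C" by (rule C(3)[OF bot(1)]) (use bot mem in blast)
  have tC: "t \<in> C" by (rule C(3)[OF top(1)]) (use top mem in blast)
  have le: "le x y" if "x \<in> C" "y \<in> C" "\<rho> x < \<rho> y" for x y
    using C(2)[OF that(1,2)] less[of y x] mem that by force
  have inj: "inj_on \<rho> C"
  proof (rule inj_onI)
    fix x y assume "x \<in> C" "y \<in> C" "\<rho> x = \<rho> y"
    then show "x = y" using C(2)[of x y] less[of x y] less[of y x] mem by force
  qed
  have "\<exists>x\<in>C. \<rho> x = r" if "r \<le> \<rho> t" for r
    using that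
  proof (induction r)
    case 0
    then show ?case using bC bot by blast
  next
    case (Suc r)
    then obtain x where x: "x \<in> C" "\<rho> x = r" by auto
    \<comment> \<open>With m the least rank above r in the chain, every element of the chain of rank
      beyond r lies weakly above the y found next.\<close>
    define m where "m = (LEAST m. \<exists>y\<in>C. \<rho> y = m \<and> r < m)"
    have "\<exists>y\<in>C. \<rho> y = m \<and> r < m" unfolding m_def
      by (rule LeastI[of _ "\<rho> t"]) (use tC Suc.prems in auto)
    then obtain y where y: "y \<in> C" "\<rho> y = m" "r < m" by blast
    have m_le: "m \<le> \<rho> c" if "c \<in> C" "r < \<rho> c" for c
      unfolding m_def by (rule Least_le) (use that in auto)
    have "x \<noteq> y" using x y by auto
    then obtain z where z: "z \<in> A" "le x z" "le z y" "\<rho> z = Suc r"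
      using between[of x y] le[of x y] x y mem by auto
    have "z \<in> C"
    proof (rule C(3)[OF z(1)])
      fix c assume c: "c \<in> C"
      show "c = z \<or> le c z \<or> le z c"
      proof (cases "\<rho> c \<le> r")
        case True
        then have "c = x \<or> le c x"
          using le[OF c x(1)] inj_onD[OF inj _ c x(1)] x by (cases "\<rho> c = r") auto
        then show ?thesis using z trans[of c x z] mem[OF c] mem[OF x(1)] by blast
      next
        case False
        then have "m \<le> \<rho> c" using m_le c by simp
        then have "c = y \<or> le y c"
          using le[OF y(1) c] inj_onD[OF inj _ c y(1)] y by (cases "\<rho> c = m") auto
        then show ?thesis using z trans[of z y c] mem[OF c] mem[OF y(1)] by blast
      qed
    qed
    then show ?case using z by blast
  qed
  moreover have "\<rho> x \<le> \<rho> t" if "x \<in> C" for x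
    using less[of x t] top mem[OF that] by (cases "x = t") (auto intro: less_imp_le)
  ultimately have "\<rho> ` C = {..\<rho> t}" by force
  then show ?thesis using card_image[OF inj] by simp
qed

section \<open>Strings as lists and as permutations\<close>

lemma concat_nth_offset:
  "i < length as \<Longrightarrow> t < length (as ! i) \<Longrightarrow>
     concat as ! (sum_list (take i (map length as)) + t) = as ! i ! t"
proof (induction as arbitrary: i)
  case (Cons a as)
  then show ?case by (cases i) (simp_all add: nth_append)
qed simp

lemma of_strings_permutes:
  assumes "distinct (concat as)" "set (concat as) = {1..length (concat as)}"
  shows "of_strings as permutes {1..length (concat as)}"
proof (rule bij_imp_permutes)
  let ?n = "length (concat as)"
  have *: "bij_betw (\<lambda>x. x - 1) {1..?n} {..<?n}"
    by (rule bij_betwI[of _ _ _ Suc]) auto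
  have "bij_betw ((!) (concat as) \<circ> (\<lambda>x. x - 1)) {1..?n} {1..?n}"
    by (rule bij_betw_trans[OF * bij_betw_nth[OF assms(1) refl assms(2)[symmetric]]])
  then show "bij_betw (of_strings as) {1..?n} {1..?n}"
    by (rule iffD1[OF bij_betw_cong, rotated]) (simp add: of_strings_def del: length_concat)
qed (auto simp: of_strings_def)

lemma simple_transp_of_strings:
  assumes "j \<in> {1..<length (concat as)}"
  shows "simple_transp j \<circ> of_strings as = of_strings (map (map (simple_transp j)) as)"
proof
  fix x
  have len: "length (concat (map (map (simple_transp j)) as)) = length (concat as)"
    by (simp add: map_concat[symmetric] del: length_concat)
  show "(simple_transp j \<circ> of_strings as) x = of_strings (map (map (simple_transp j)) as) x"
  proof (cases "1 \<le> x \<and> x \<le> length (concat as)")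
    case True
    then show ?thesis
      unfolding of_strings_def comp_def len
      by (auto simp: map_concat[symmetric] nth_map simp del: length_concat)
  next
    case False
    \<comment> \<open>Beyond the listed positions \<open>of_strings\<close> is the identity; the
      bound on j keeps s_j idle there too.\<close>
    then have "simple_transp j x = x" using assms by (intro simple_transp_other) auto
    then show ?thesis using False unfolding of_strings_def comp_def len by auto
  qed
qed

lemma sorted_list_of_set_image:
  assumes "finite A" "strict_mono_on A g"
  shows "sorted_list_of_set (g ` A) = map g (sorted_list_of_set A)"
proof -
  have "sorted_wrt (<) (map g (sorted_list_of_set A))"
    unfolding sorted_wrt_map
    by (rule sorted_wrt_mono_rel[OF _ strict_sorted_list_of_set])
      (use assms in \<open>auto simp: strict_mono_on_def\<close>)
  then show ?thesis
    using assms sorted_list_of_set_unique[of "g ` A" "map g (sorted_list_of_set A)"]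
    by (simp add: card_image strict_mono_on_imp_inj_on)
qed

text \<open>Sorting a rearrangement of A recovers the increasing list of A, so the zip in
  \<open>string_perm\<close> pairs each x with f x.\<close>

lemma string_perm_map_sorted:
  assumes "finite A" "f ` A = A"
  shows "string_perm (map f (sorted_list_of_set A)) x = (if x \<in> A then f x else x)"
proof -
  let ?l = "sorted_list_of_set A"
  have "distinct (map f ?l)"
    using assms by (simp add: distinct_map eq_card_imp_inj_on)
  then have "sort (map f ?l) = ?l"
    using assms by (metis finite_set list.set_map set_sorted_list_of_set
      sorted_list_of_set_sort_remdups distinct_remdups_id sorted_list_of_set.idem_if_sorted_distinct)
  then show ?thesis
    using assms by (auto simp: string_perm_def permutation_of_list_def map_of_zip_map)
qed

section \<open>Partial sums and the strings they cut out\<close>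

lemma nu_0 [simp]: "nu mu 0 = 0"
  by (simp add: nu_def)

lemma nu_Suc: "i < length mu \<Longrightarrow> nu mu (Suc i) = nu mu i + mu ! i"
  by (simp add: nu_def take_Suc_conv_app_nth)

lemma nu_length: "nu mu (length mu) = sum_list mu"
  by (simp add: nu_def)

lemma nu_mono: "i \<le> k \<Longrightarrow> nu mu i \<le> nu mu k"
  unfolding nu_def by (metis le_add1 min.absorb1 sum_list_append take_add take_take le_Suc_ex)

lemma nu_le_sum: "nu mu i \<le> sum_list mu"
  unfolding nu_def by (metis append_take_drop_id le_add1 sum_list_append)

lemma mu_strings_of_strings:
  assumes "map length as = mu"
  shows "mu_strings mu (of_strings as) = as"
proof (rule nth_equalityI)
  have len: "length mu = length as" "length (concat as) = sum_list mu"
    using assms by (auto simp: length_concat)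
  then show "length (mu_strings mu (of_strings as)) = length as" by (simp add: mu_strings_def)
  fix i assume "i < length (mu_strings mu (of_strings as))"
  then have i: "i < length as" using len by (simp add: mu_strings_def)
  then have mui: "mu ! i = length (as ! i)" using assms by auto
  have nui: "nu mu (Suc i) = nu mu i + length (as ! i)" using i len mui by (simp add: nu_Suc)
  have "mu_string mu i (of_strings as) = as ! i"
  proof (rule nth_equalityI)
    show "length (mu_string mu i (of_strings as)) = length (as ! i)"
      by (simp add: mu_string_def nui del: upt_Suc)
    fix t assume "t < length (mu_string mu i (of_strings as))"
    then have t: "t < length (as ! i)" by (simp add: mu_string_def nui del: upt_Suc)
    then have "nu mu i + t < sum_list mu" using nui nu_le_sum[of mu "Suc i"] by simp
    then have "mu_string mu i (of_strings as) ! t = concat as ! (nu mu i + t)"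
      using t len by (simp add: mu_string_def nui of_strings_def del: length_concat upt_Suc)
    also have "\<dots> = as ! i ! t"
      using concat_nth_offset[OF i t] assms by (simp add: nu_def)
    finally show "mu_string mu i (of_strings as) ! t = as ! i ! t" .
  qed
  then show "mu_strings mu (of_strings as) ! i = as ! i"
    using i len by (simp add: mu_strings_def)
qed

lemma concat_mu_strings: "concat (mu_strings mu p) = map p [1..<Suc (sum_list mu)]"
proof -
  have "concat (map (\<lambda>i. mu_string mu i p) [0..<k]) = map p [1..<Suc (nu mu k)]" for k
  proof (induction k)
    case (Suc k)
    have "[1..<Suc (nu mu (Suc k))] = [1..<Suc (nu mu k)] @ [Suc (nu mu k)..<Suc (nu mu (Suc k))]"
      using upt_add_eq_append[of 1 "Suc (nu mu k)" "nu mu (Suc k) - nu mu k"] nu_mono[of k "Suc k" mu] by simp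
    then show ?case using Suc by (simp add: mu_string_def)
  qed simp
  then show ?thesis by (simp add: mu_strings_def flip: nu_length)
qed

lemma of_strings_mu_strings:
  assumes "p permutes {1..sum_list mu}"
  shows "of_strings (mu_strings mu p) = p"
proof
  fix x
  show "of_strings (mu_strings mu p) x = p x"
    using permutes_not_in[OF assms, of x] unfolding of_strings_def concat_mu_strings
    by (auto simp del: upt_Suc)
qed

subsection \<open>Encoding of mu-involutions\<close>

locale mu_blocks =
  fixes mu :: "nat list"
begin

text \<open>Beyond \<open>sum_list mu\<close> no index qualifies and the value is unspecified;
  states agree with \<open>block\<close> there, so it does not disturb the injectivity of
  \<open>encode\<close>.\<close>

definition block :: "nat \<Rightarrow> nat" where
  "block x = (LEAST i. x \<le> nu mu (Suc i))"

lemma block_le: "x \<le> nu mu (Suc i) \<Longrightarrow> block x \<le> i"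
  unfolding block_def by (rule Least_le)

text \<open>\<open>take\<close> past the end returns all of \<open>mu\<close>, so
  \<open>length mu\<close> is a witness for \<open>LEAST\<close>.\<close>

lemma le_nu_block: "x \<le> sum_list mu \<Longrightarrow> x \<le> nu mu (Suc (block x))"
  unfolding block_def by (rule LeastI[of _ "length mu"]) (simp add: nu_def)

lemma nu_block_less:
  assumes "1 \<le> x" shows "nu mu (block x) < x"
proof (cases "block x")
  case (Suc i)
  show ?thesis
  proof (rule ccontr)
    assume "\<not> nu mu (block x) < x"
    then show False using block_le[of x i] Suc by simp
  qed
qed (use assms in simp)

lemma block_eqI:
  assumes "nu mu i < x" "x \<le> nu mu (Suc i)" shows "block x = i"
proof -
  have "x \<le> nu mu (Suc (block x))"
    using assms le_nu_block nu_le_sum[of mu "Suc i"] by simp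
  then have "\<not> Suc (block x) \<le> i" using nu_mono[of "Suc (block x)" i mu] assms by linarith
  then show ?thesis using block_le[OF assms(2)] by simp
qed

lemma block_less_length: "x \<in> {1..sum_list mu} \<Longrightarrow> block x < length mu"
  using nu_block_less[of x] le_nu_block[of x] nu_mono[of "length mu" "block x" mu] nu_length[of mu]
  by (cases "block x < length mu") auto

sublocale block_order "sum_list mu" block
proof
  fix x y assume "y \<in> {1..sum_list mu}" "x \<le> y"
  then show "block x \<le> block y"
    using block_le[of x "block y"] le_nu_block[of y] by simp
qed

section \<open>From states to one-line notation\<close>

definition fibre :: "(nat \<Rightarrow> nat) \<Rightarrow> nat \<Rightarrow> nat set" where
  "fibre b i = {x \<in> {1..sum_list mu}. b x = i}"

text \<open>Inverse to reading off string permutations: listing f along the increasing entry set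
  gives a string whose permutation is f on that set.\<close>

definition encode :: "(nat \<Rightarrow> nat) \<times> (nat \<Rightarrow> nat) \<Rightarrow> nat \<Rightarrow> nat" where
  "encode S = (case S of (b, f) \<Rightarrow>
     of_strings (map (\<lambda>i. map f (sorted_list_of_set (fibre b i))) [0..<length mu]))"

lemma finite_fibre [simp]: "finite (fibre b i)"
  by (simp add: fibre_def)

lemma fibre_block: "i < length mu \<Longrightarrow> fibre block i = {nu mu i<..nu mu (Suc i)}"
  using nu_le_sum[of mu "Suc i"] nu_block_less le_nu_block block_eqI
  by (fastforce simp: fibre_def)

lemma fibre_comp:
  assumes u: "u permutes {1..sum_list mu}"
  shows "fibre (b \<circ> inv u) i = u ` fibre b i"
proof -
  have "x \<in> fibre (b \<circ> inv u) i \<longleftrightarrow> inv u x \<in> fibre b i" for x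
    using permutes_in_image[OF permutes_inv[OF u], of x] by (auto simp: fibre_def)
  then have "fibre (b \<circ> inv u) i = inv u -` fibre b i" by auto
  then show ?thesis using bij_vimage_eq_inv_image[OF permutes_bij[OF permutes_inv[OF u]]]
    by (simp add: permutes_inv_inv[OF u])
qed

text \<open>The witness in \<open>states\<close> carries a fibre of b onto the positions of the
  corresponding string.\<close>

lemma card_fibre:
  assumes S: "(b, f) \<in> states" and i: "i < length mu"
  shows "card (fibre b i) = mu ! i"
proof -
  obtain u where u: "u permutes {1..sum_list mu}" "b = block \<circ> u"
    using S by (auto simp: states_def)
  have "fibre b i = inv u ` fibre block i"
    using fibre_comp[OF permutes_inv[OF u(1)], of block i] permutes_inv_inv[OF u(1)] u(2) by simp
  moreover have "inj_on (inv u) (fibre block i)"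
    using permutes_inj[OF permutes_inv[OF u(1)]] by (rule inj_on_subset) simp
  ultimately show ?thesis using i by (simp add: card_image fibre_block nu_Suc)
qed

lemma image_fibre:
  assumes "(b, f) \<in> states"
  shows "f ` fibre b i = fibre b i"
proof -
  have "f x \<in> fibre b i" if "x \<in> fibre b i" for x
    using that statesD[OF assms] permutes_in_image[OF statesD(1)[OF assms], of x] by (simp add: fibre_def)
  note closed = this
  show ?thesis
  proof (intro subset_antisym subsetI)
    fix x assume "x \<in> fibre b i"
    then show "x \<in> f ` fibre b i"
      using closed statesD(2)[OF assms, of x] by (metis imageI)
  qed (use closed in auto)
qed

lemma state_block_less:
  assumes "(b, f) \<in> states" "x \<in> {1..sum_list mu}"
  shows "b x < length mu"
proof -
  obtain u where u: "u permutes {1..sum_list mu}" "b = block \<circ> u"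
    using assms by (auto simp: states_def)
  then show ?thesis
    using block_less_length[of "u x"] permutes_in_image[OF u(1), of x] assms(2) by simp
qed

lemma state_outside:
  assumes "(b, f) \<in> states" "x \<notin> {1..sum_list mu}"
  shows "b x = block x" "f x = x"
proof -
  obtain u where u: "u permutes {1..sum_list mu}" "b = block \<circ> u"
    using assms by (auto simp: states_def)
  show "b x = block x" using permutes_not_in[OF u(1) assms(2)] u(2) by simp
  show "f x = x" by (rule permutes_not_in[OF statesD(1)[OF assms(1)] assms(2)])
qed

lemma mu_strings_encode:
  assumes "(b, f) \<in> states"
  shows "mu_strings mu (encode (b, f)) = map (\<lambda>i. map f (sorted_list_of_set (fibre b i))) [0..<length mu]"
  unfolding encode_def split
  by (rule mu_strings_of_strings, rule nth_equalityI) (simp_all add: card_fibre[OF assms])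

lemma mu_string_encode:
  assumes "(b, f) \<in> states" "i < length mu"
  shows "mu_string mu i (encode (b, f)) = map f (sorted_list_of_set (fibre b i))"
proof -
  have "mu_string mu i (encode (b, f)) = mu_strings mu (encode (b, f)) ! i"
    using assms(2) by (simp add: mu_strings_def)
  then show ?thesis using assms(2) by (simp add: mu_strings_encode[OF assms(1)])
qed

lemma string_perm_encode:
  assumes "(b, f) \<in> states"
  shows "string_perm (map f (sorted_list_of_set (fibre b i))) x = (if x \<in> fibre b i then f x else x)"
  by (rule string_perm_map_sorted[OF finite_fibre image_fibre[OF assms]])

lemma length_concat_encode:
  assumes "(b, f) \<in> states"
  shows "length (concat (map (\<lambda>i. map f (sorted_list_of_set (fibre b i))) [0..<length mu])) = sum_list mu"
proof -
  have "map length (map (\<lambda>i. map f (sorted_list_of_set (fibre b i))) [0..<length mu]) = mu"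
    by (rule nth_equalityI) (simp_all add: card_fibre[OF assms])
  then show ?thesis by (metis length_concat)
qed

lemma encode_permutes:
  assumes S: "(b, f) \<in> states"
  shows "encode (b, f) permutes {1..sum_list mu}"
proof -
  let ?as = "map (\<lambda>i. map f (sorted_list_of_set (fibre b i))) [0..<length mu]"
  have "set (concat ?as) = (\<Union>i<length mu. fibre b i)"
    by (auto simp: image_fibre[OF S] simp flip: atLeast0LessThan)
  also have "\<dots> = {1..sum_list mu}"
    using state_block_less[OF S] by (auto simp: fibre_def)
  finally have set: "set (concat ?as) = {1..sum_list mu}" .
  \<comment> \<open>By counting: as many entries as values, and every value occurs.\<close>
  moreover have "distinct (concat ?as)"
    by (rule card_distinct) (unfold set length_concat_encode[OF S], simp)
  ultimately show ?thesis
    using of_strings_permutes[of ?as] length_concat_encode[OF S] by (simp add: encode_def)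
qed

lemma encode_mu_involution:
  assumes "S \<in> states"
  shows "encode S \<in> mu_involutions mu"
proof (cases S)
  case (Pair b f)
  note S = assms[unfolded Pair]
  have closed: "f x \<in> fibre b i" if "x \<in> fibre b i" for x i using that image_fibre[OF S] by blast
  have "string_perm (mu_string mu i (encode S)) \<circ> string_perm (mu_string mu i (encode S)) = id"
    if "i < length mu" for i
  proof
    fix x
    show "(string_perm (mu_string mu i (encode S)) \<circ> string_perm (mu_string mu i (encode S))) x = id x"
      using closed[of x i] statesD(2)[OF S, of x]
      by (simp add: Pair mu_string_encode[OF S that] string_perm_encode[OF S])
  qed
  then show ?thesis
    using encode_permutes[OF S] by (simp add: mu_involutions_def Pair)
qed

text \<open>The entry sets of the strings determine b, the strings then determine f, and outside
  \<open>{1..sum_list mu}\<close> both are prescribed by \<open>states\<close>.\<close>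

lemma inj_on_encode: "inj_on encode states"
proof (rule inj_onI)
  fix S S' assume S: "S \<in> states" "S' \<in> states" and eq: "encode S = encode S'"
  obtain b f b' f' where p: "S = (b, f)" "S' = (b', f')" by (cases S, cases S') blast
  note S = S[unfolded p]
  have str: "map f (sorted_list_of_set (fibre b i)) = map f' (sorted_list_of_set (fibre b' i))"
    if "i < length mu" for i
    using that eq mu_string_encode[OF S(1)] mu_string_encode[OF S(2)] unfolding p by metis
  have fib: "fibre b i = fibre b' i" if "i < length mu" for i
  proof -
    have "f ` fibre b i = f' ` fibre b' i"
      using arg_cong[OF str[OF that], of set] by simp
    then show ?thesis using image_fibre[OF S(1)] image_fibre[OF S(2)] by simp
  qed
  have "b x = b' x \<and> f x = f' x" for x
  proof (cases "x \<in> {1..sum_list mu}")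
    case True
    then have "x \<in> fibre b (b x)" and bx: "b x < length mu"
      using state_block_less[OF S(1)] by (auto simp: fibre_def)
    then have "x \<in> fibre b' (b x)" using fib by blast
    moreover have "f x = f' x"
      using str[OF bx] \<open>x \<in> fibre b (b x)\<close> unfolding fib[OF bx] by simp
    ultimately show ?thesis by (simp add: fibre_def)
  next
    case False
    then show ?thesis using state_outside[OF S(1)] state_outside[OF S(2)] by simp
  qed
  then show "S = S'" by (auto simp: p)
qed

text \<open>Since f is an involution, x appears where the increasing list of its string has f x. The
  index t counts from zero, positions count from one.\<close>

lemma inv_encode:
  assumes S: "(b, f) \<in> states" and x: "x \<in> {1..sum_list mu}"
  obtains t where "inv (encode (b, f)) x = nu mu (b x) + Suc t" "t < card (fibre b (b x))"
    "sorted_list_of_set (fibre b (b x)) ! t = f x"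
proof -
  have "x \<in> fibre b (b x)" using x by (simp add: fibre_def)
  then have "f x \<in> set (sorted_list_of_set (fibre b (b x)))" using image_fibre[OF S] by auto
  then obtain t where t: "t < card (fibre b (b x))" "sorted_list_of_set (fibre b (b x)) ! t = f x"
    unfolding in_set_conv_nth length_sorted_list_of_set by blast
  have bx: "b x < length mu" by (rule state_block_less[OF S x])
  have t': "t < mu ! (b x)" using t card_fibre[OF S bx] by simp
  have "mu_string mu (b x) (encode (b, f)) ! t = encode (b, f) (nu mu (b x) + Suc t)"
    using t' bx by (simp add: mu_string_def nu_Suc del: upt_Suc)
  then have "encode (b, f) (nu mu (b x) + Suc t) = x"
    using t statesD(2)[OF S] by (simp add: mu_string_encode[OF S bx])
  then have "inv (encode (b, f)) x = nu mu (b x) + Suc t"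
    using permutes_inverses(2)[OF encode_permutes[OF S]] by metis
  then show thesis using t that by blast
qed

text \<open>Strings come in the order of b, and inside one the place of x grows with f x; this
  justifies the descent test in \<open>simple_step\<close>.\<close>

lemma inv_encode_less:
  assumes S: "(b, f) \<in> states" and x: "x \<in> {1..sum_list mu}" and y: "y \<in> {1..sum_list mu}"
    and key: "b x < b y \<or> b x = b y \<and> f x < f y"
  shows "inv (encode (b, f)) x < inv (encode (b, f)) y"
proof -
  obtain t where t: "inv (encode (b, f)) x = nu mu (b x) + Suc t" "t < card (fibre b (b x))"
    "sorted_list_of_set (fibre b (b x)) ! t = f x" by (rule inv_encode[OF S x])
  obtain r where r: "inv (encode (b, f)) y = nu mu (b y) + Suc r" "r < card (fibre b (b y))"
    "sorted_list_of_set (fibre b (b y)) ! r = f y" by (rule inv_encode[OF S y])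
  show ?thesis
  proof (cases "b x < b y")
    case True
    have "nu mu (b x) + Suc t \<le> nu mu (Suc (b x))"
      using t(2) card_fibre[OF S] state_block_less[OF S x] by (simp add: nu_Suc)
    also have "\<dots> \<le> nu mu (b y)" using True by (intro nu_mono) simp
    finally show ?thesis using t(1) r(1) by simp
  next
    case False
    then have eq: "b x = b y" and lt: "f x < f y" using key by auto
    have "t < r"
    proof (rule ccontr)
      assume "\<not> t < r"
      then have "sorted_list_of_set (fibre b (b y)) ! r \<le> sorted_list_of_set (fibre b (b y)) ! t"
        using t(2) eq by (intro sorted_nth_mono) auto
      then show False using t(3) r(3) lt eq by simp
    qed
    then show ?thesis using t(1) r(1) eq by simp
  qed
qed

lemma inv_encode_descent_iff:
  assumes S: "(b, f) \<in> states" and j: "j \<in> {1..<sum_list mu}"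
  shows "inv (encode (b, f)) (Suc j) < inv (encode (b, f)) j \<longleftrightarrow>
    b (Suc j) < b j \<or> b j = b (Suc j) \<and> f (Suc j) < f j"
proof -
  have jn: "j \<in> {1..sum_list mu}" "Suc j \<in> {1..sum_list mu}" using j by auto
  have "f j \<noteq> f (Suc j)" using statesD(2)[OF S] by (metis n_not_Suc_n)
  then show ?thesis
    using inv_encode_less[OF S jn] inv_encode_less[OF S jn(2,1)] by linarith
qed

section \<open>The action under the encoding\<close>

lemma act_string_encode:
  assumes S: "(b, f) \<in> states" and j: "j \<in> fibre b i" "Suc j \<in> fibre b i"
  shows "act_string j (map f (sorted_list_of_set (fibre b i))) =
    map (if f j = j \<and> f (Suc j) = Suc j then simple_transp j \<circ> f else simple_transp j \<circ> f \<circ> simple_transp j)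
      (sorted_list_of_set (fibre b i))"
proof -
  let ?s = "simple_transp j"
  have s: "?s x \<in> fibre b i" if "x \<in> fibre b i" for x
    using that j by (cases "x = j \<or> x = Suc j") (auto simp: simple_transp_other)
  have set: "set (map f (sorted_list_of_set (fibre b i))) = fibre b i"
    using image_fibre[OF S] by simp
  show ?thesis
    unfolding act_string_def Let_def string_of_def set
    using j s by (auto simp: string_perm_encode[OF S])
qed

lemma simple_act_encode:
  assumes S: "S \<in> states" and j: "j \<in> {1..<sum_list mu}"
  shows "simple_act mu j (encode S) = encode (simple_step j S)"
proof (cases S)
  case (Pair b f)
  let ?s = "simple_transp j"
  let ?g = "if f j = j \<and> f (Suc j) = Suc j then ?s \<circ> f else ?s \<circ> f \<circ> ?s"
  let ?str = "\<lambda>i. map f (sorted_list_of_set (fibre b i))"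
  note S = S[unfolded Pair]
  have jn: "j \<in> {1..sum_list mu}" "Suc j \<in> {1..sum_list mu}" using j by auto
  have fib: "j \<in> fibre b i \<longleftrightarrow> i = b j" "Suc j \<in> fibre b i \<longleftrightarrow> i = b (Suc j)" for i
    using jn by (auto simp: fibre_def)
  have set: "set (?str i) = fibre b i" for i using image_fibre[OF S] by simp
  have ex: "(\<exists>a\<in>set (mu_strings mu (encode (b, f))). j \<in> set a \<and> j + 1 \<in> set a) \<longleftrightarrow> b j = b (Suc j)"
  proof -
    have "(\<exists>a\<in>set (mu_strings mu (encode (b, f))). j \<in> set a \<and> j + 1 \<in> set a) \<longleftrightarrow>
        (\<exists>i\<in>{0..<length mu}. j \<in> fibre b i \<and> Suc j \<in> fibre b i)"
      by (simp add: mu_strings_encode[OF S] image_fibre[OF S])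
    then show ?thesis using state_block_less[OF S jn(1)] unfolding fib by auto
  qed
  note desc = inv_encode_descent_iff[OF S j]
  consider (descent) "b (Suc j) < b j \<or> b j = b (Suc j) \<and> f (Suc j) < f j"
    | (same) "b j = b (Suc j)" "\<not> f (Suc j) < f j" | (distinct) "b j < b (Suc j)"
    by linarith
  then show ?thesis
  proof cases
    case descent
    then show ?thesis using desc by (simp add: simple_act_def Pair simple_step_def)
  next
    case same
    have bs: "b \<circ> ?s = b"
    proof
      fix x show "(b \<circ> ?s) x = b x"
        using same by (cases "x = j \<or> x = Suc j") (auto simp: simple_transp_other)
    qed
    have "(if j \<in> set (?str i) \<and> j + 1 \<in> set (?str i) then act_string j (?str i) else ?str i) =
        map ?g (sorted_list_of_set (fibre b i))" for i
    proof (cases "i = b j")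
      case True
      then have "j \<in> fibre b i" "Suc j \<in> fibre b i" unfolding fib using same(1) by simp_all
      then show ?thesis unfolding set by (simp add: act_string_encode[OF S])
    next
      case False
      \<comment> \<open>Another string is closed under f and contains neither j nor j + 1, so s_j is
        idle on it.\<close>
      have "?g x = f x" if "x \<in> fibre b i" for x
      proof -
        have "f x \<in> fibre b i" using that image_fibre[OF S] by blast
        then have "b x = i" "b (f x) = i" using that by (simp_all add: fibre_def)
        then have "x \<noteq> j" "x \<noteq> Suc j" "f x \<noteq> j" "f x \<noteq> Suc j"
          using False same(1) by auto
        then show ?thesis by (simp add: simple_transp_other)
      qed
      moreover have "j \<notin> fibre b i" using False fib by blast
      ultimately show ?thesis unfolding set by simp
    qed
    then have "map (\<lambda>a. if j \<in> set a \<and> j + 1 \<in> set a then act_string j a else a) (mu_strings mu (encode (b, f))) =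
        map (\<lambda>i. map ?g (sorted_list_of_set (fibre b i))) [0..<length mu]"
      unfolding mu_strings_encode[OF S] map_map comp_def by (intro map_cong refl)
    moreover have "\<not> inv (encode (b, f)) (j + 1) < inv (encode (b, f)) j"
      using desc same by simp
    ultimately have "simple_act mu j (encode (b, f)) = encode (b, ?g)"
      using ex same(1) unfolding simple_act_def encode_def split by presburger
    moreover have "simple_step j (b, f) = (b, ?g)"
      using same bs by (simp add: simple_step_def)
    ultimately show ?thesis by (simp add: Pair)
  next
    case distinct
    \<comment> \<open>No string contains both j and j + 1, so s_j preserves the order on each entry
      set and increasing lists stay increasing.\<close>
    have mono: "strict_mono_on (fibre b i) ?s" for i
      using distinct by (auto simp: strict_mono_on_def simple_transp_less_iff fibre_def)
    have sp: "?s permutes {1..sum_list mu}" by (rule simple_transp_permutes[OF j])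
    have "inv ?s = ?s" by (rule inv_unique_comp) simp_all
    then have "sorted_list_of_set (fibre (b \<circ> ?s) i) = map ?s (sorted_list_of_set (fibre b i))" for i
      using fibre_comp[OF sp, of b i] sorted_list_of_set_image[OF finite_fibre mono] by simp
    then have "encode (b \<circ> ?s, ?s \<circ> f \<circ> ?s) = of_strings (map (map ?s) (map ?str [0..<length mu]))"
      by (simp add: encode_def comp_def)
    also have "\<dots> = ?s \<circ> encode (b, f)"
      using simple_transp_of_strings[of j "map ?str [0..<length mu]"] j length_concat_encode[OF S]
      by (simp add: encode_def)
    finally have "encode (b \<circ> ?s, ?s \<circ> f \<circ> ?s) = ?s \<circ> encode (b, f)" .
    moreover have "simple_act mu j (encode (b, f)) = ?s \<circ> encode (b, f)"
    proof -
      have "\<not> inv (encode (b, f)) (j + 1) < inv (encode (b, f)) j"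
        using desc distinct by simp
      then show ?thesis using ex distinct unfolding simple_act_def by (metis less_irrefl)
    qed
    moreover have "simple_step j (b, f) = (b \<circ> ?s, ?s \<circ> f \<circ> ?s)"
      using distinct by (simp add: simple_step_def)
    ultimately show ?thesis by (simp add: Pair)
  qed
qed

lemma foldr_simple_act_encode:
  "S \<in> states \<Longrightarrow> set js \<subseteq> {1..<sum_list mu} \<Longrightarrow>
     foldr (simple_act mu) js (encode S) = encode (word_step js S)"
proof (induction js)
  case (Cons j js)
  then show ?case using simple_act_encode[OF word_step_states[of S js]] by simp
qed simp

text \<open>The word chosen inside \<open>perm_act\<close> is known only to be reduced, so whatever
  is built on this must hold for every reduced word.\<close>

lemma perm_act_encode:
  assumes "w permutes {1..sum_list mu}" "S \<in> states"
  obtains js where "reduced_expression (sum_list mu) js w" "perm_act mu w (encode S) = encode (word_step js S)"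
proof -
  let ?js = "SOME js. reduced_expression (sum_list mu) js w"
  have "reduced_expression (sum_list mu) ?js w"
    using reduced_expression_exists[OF assms(1)] by (rule someI_ex)
  moreover from this have "set ?js \<subseteq> {1..<sum_list mu}" by (simp only: reduced_expression_iff)
  then have "perm_act mu w (encode S) = encode (word_step ?js S)"
    unfolding perm_act_def by (rule foldr_simple_act_encode[OF assms(2)])
  ultimately show thesis by (rule that)
qed

section \<open>The order, its rank and the W-sets\<close>

text \<open>From right to left a given word must be traded for the reduced expression that
  \<open>perm_act\<close> happens to choose; \<open>reaches_reduced\<close> permits this for states
  reachable from \<open>initial\<close>.\<close>

lemma rev_weak_le_encode_iff:
  assumes S: "reaches initial S" and S': "S' \<in> states"
  shows "rev_weak_le mu (encode S) (encode S') \<longleftrightarrow> reaches S S'"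
proof
  have st: "S \<in> states" using reaches_states[OF S initial_states] .
  {
    assume "rev_weak_le mu (encode S) (encode S')"
    then obtain w where w: "w permutes {1..sum_list mu}" "encode S' = perm_act mu w (encode S)"
      by (auto simp: rev_weak_le_def)
    obtain js where js: "reduced_expression (sum_list mu) js w"
      "perm_act mu w (encode S) = encode (word_step js S)"
      by (rule perm_act_encode[OF w(1) st])
    then have set: "set js \<subseteq> {1..<sum_list mu}" by (simp only: reduced_expression_iff)
    have "S' = word_step js S"
      using inj_onD[OF inj_on_encode _ S' word_step_states[OF st set]] w(2) js(2) by simp
    then show "reaches S S'" using set unfolding reaches_def by blast
  next
    assume "reaches S S'"
    then obtain w where w: "w permutes {1..sum_list mu}"
      "\<And>js. reduced_expression (sum_list mu) js w \<Longrightarrow> word_step js S = S'"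
      using reaches_reduced[OF S] by blast
    obtain js where "reduced_expression (sum_list mu) js w"
      "perm_act mu w (encode S) = encode (word_step js S)"
      by (rule perm_act_encode[OF w(1) st])
    then have "encode S' = perm_act mu w (encode S)" using w(2) by simp
    then show "rev_weak_le mu (encode S) (encode S')"
      using w(1) encode_mu_involution[OF st] encode_mu_involution[OF S'] unfolding rev_weak_le_def by blast
  }
qed

lemma encode_initial: "encode initial = id"
proof -
  have "sorted_list_of_set (fibre block i) = mu_string mu i id" if "i < length mu" for i
    using fibre_block[OF that]
    by (simp add: mu_string_def atLeastSucAtMost_greaterThanAtMost[symmetric] atLeastLessThanSuc_atLeastAtMost[symmetric] del: upt_Suc)
  then have "encode initial = of_strings (mu_strings mu id)"
    unfolding encode_def initial_def mu_strings_def split by (intro arg_cong[of _ _ of_strings] map_cong) simp_all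
  then show ?thesis by (simp add: of_strings_mu_strings[OF permutes_id])
qed

lemma mu_rank_encode:
  assumes S: "reaches initial S"
  shows "mu_rank mu (encode S) = rk S"
proof -
  let ?A = "{q. rev_weak_le mu id q \<and> rev_weak_le mu q (encode S)}"
  have st: "S \<in> states" using reaches_states[OF S initial_states] .
  have le_id: "rev_weak_le mu id (encode T) \<longleftrightarrow> reaches initial T" if "T \<in> states" for T
    using rev_weak_le_encode_iff[OF reaches_refl that] by (simp add: encode_initial)
  have A: "q \<in> ?A \<longleftrightarrow> (\<exists>T. q = encode T \<and> T \<in> states \<and> reaches initial T \<and> reaches T S)" for q
  proof
    assume q: "q \<in> ?A"
    then obtain w where w: "w permutes {1..sum_list mu}" "q = perm_act mu w id"
      by (auto simp: rev_weak_le_def)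
    obtain js where js: "reduced_expression (sum_list mu) js w" "q = encode (word_step js initial)"
      using perm_act_encode[OF w(1) initial_states] w(2) by (metis encode_initial)
    then have T: "word_step js initial \<in> states"
      using word_step_states[OF initial_states] by (simp only: reduced_expression_iff)
    show "\<exists>T. q = encode T \<and> T \<in> states \<and> reaches initial T \<and> reaches T S"
      using q js(2) T le_id[OF T] rev_weak_le_encode_iff[OF _ st] by blast
  next
    assume "\<exists>T. q = encode T \<and> T \<in> states \<and> reaches initial T \<and> reaches T S"
    then show "q \<in> ?A" using le_id rev_weak_le_encode_iff[OF _ st] by blast
  qed
  \<comment> \<open>\<open>rk\<close> lives on states; injectivity of \<open>encode\<close> carries
    it over to involutions.\<close>
  define \<rho> where "\<rho> q = rk (the_inv_into states encode q)" for q
  have \<rho>: "\<rho> (encode T) = rk T" if "T \<in> states" for T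
    unfolding \<rho>_def by (simp add: the_inv_into_f_f[OF inj_on_encode that])
  have card: "card C = Suc (rk S)" if C: "pred_on.maxchain ?A (rev_weak_le mu) C" for C
    unfolding \<rho>[OF st, symmetric]
  proof (rule card_maxchain_graded[OF _ _ _ _ _ _ _ _ C, where b = id and \<rho> = \<rho> and t = "encode S"])
    fix x y z assume "x \<in> ?A" "y \<in> ?A" "z \<in> ?A" "rev_weak_le mu x y" "rev_weak_le mu y z"
    then show "rev_weak_le mu x z"
      using rev_weak_le_encode_iff reaches_trans unfolding A by metis
  next
    fix x y assume xy: "x \<in> ?A" "y \<in> ?A" "rev_weak_le mu x y" "x \<noteq> y"
    then obtain X Y where X: "x = encode X" "X \<in> states" "reaches initial X"
      and Y: "y = encode Y" "Y \<in> states" "reaches Y S" unfolding A by blast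
    have XY: "reaches X Y" "X \<noteq> Y" using xy rev_weak_le_encode_iff[OF X(3) Y(2)] X Y by auto
    then show "\<rho> x < \<rho> y" using rk_reaches_less[OF X(2)] X Y \<rho> by simp
    obtain Z where Z: "reaches X Z" "reaches Z Y" "rk Z = Suc (rk X)"
      by (rule reaches_intermediate[OF X(2) XY])
    have Zs: "Z \<in> states" "reaches initial Z" "reaches Z S"
      using Z X Y reaches_states reaches_trans by blast+
    show "\<exists>z\<in>?A. rev_weak_le mu x z \<and> rev_weak_le mu z y \<and> \<rho> z = Suc (\<rho> x)"
    proof (intro bexI conjI)
      show "encode Z \<in> ?A" unfolding A using Zs by blast
      show "rev_weak_le mu x (encode Z)" "rev_weak_le mu (encode Z) y"
        using Z Zs X Y rev_weak_le_encode_iff by auto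
      show "\<rho> (encode Z) = Suc (\<rho> x)" using \<rho> Z Zs X by simp
    qed
  next
    show "id \<in> ?A" unfolding A
      using encode_initial[symmetric] initial_states reaches_refl S by blast
    show "\<rho> id = 0" using \<rho>[OF initial_states] rk_initial by (simp add: encode_initial)
    show "encode S \<in> ?A" unfolding A using st S reaches_refl by blast
  qed auto
  \<comment> \<open>The Hausdorff principle supplies a maximal chain, hence a witness for the
    definite description in \<open>mu_rank\<close>.\<close>
  obtain C where C: "pred_on.maxchain ?A (rev_weak_le mu) C"
    using pred_on.Hausdorff by blast
  show ?thesis
    unfolding mu_rank_def
  proof (rule the_equality)
    show "\<exists>C. pred_on.maxchain ?A (rev_weak_le mu) C \<and> card C = rk S + 1"
      using C card[OF C] by auto
    fix r assume "\<exists>C. pred_on.maxchain ?A (rev_weak_le mu) C \<and> card C = r + 1"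
    then show "r = rk S" using card by auto
  qed
qed

text \<open>A word of length \<open>rk S\<close> leading from \<open>initial\<close> to S is strict,
  so its permutation is \<open>good\<close> for S; conversely \<open>word_step_reduced\<close> makes
  the word chosen by \<open>perm_act\<close> end in S with the right length.\<close>

lemma W_set_encode:
  assumes S: "reaches initial S"
  shows "W_set mu (encode S) =
    {w. w permutes {1..sum_list mu} \<and> fst S = block \<circ> inv w \<and> good (sum_list mu) (inv w) S}"
    (is "_ = ?G")
proof (intro set_eqI iffI)
  have st: "S \<in> states" using reaches_states[OF S initial_states] .
  fix w
  {
    assume "w \<in> W_set mu (encode S)"
    then have w: "w permutes {1..sum_list mu}" "perm_act mu w (encode initial) = encode S"
      "perm_length (sum_list mu) w = rk S"
      by (simp_all add: W_set_def mu_rank_encode[OF S] encode_initial)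
    obtain js where js: "reduced_expression (sum_list mu) js w"
      "perm_act mu w (encode initial) = encode (word_step js initial)"
      by (rule perm_act_encode[OF w(1) initial_states])
    then have set: "set js \<subseteq> {1..<sum_list mu}" "word_perm js = w" "length js = rk S"
      using w(3) by (simp_all only: reduced_expression_iff)
    have "word_step js initial = S"
      using inj_onD[OF inj_on_encode _ word_step_states[OF initial_states set(1)] st] w(2) js(2) by simp
    then show "w \<in> ?G" using good_word_step[OF set(1)] set w(1) by simp
  next
    assume "w \<in> ?G"
    then have w: "w permutes {1..sum_list mu}" "fst S = block \<circ> inv w" "good (sum_list mu) (inv w) S"
      by simp_all
    obtain js where js: "reduced_expression (sum_list mu) js w"
      "perm_act mu w (encode initial) = encode (word_step js initial)"
      by (rule perm_act_encode[OF w(1) initial_states])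
    have "word_step js initial = S" "rk S = length js"
      using word_step_reduced[OF js(1) w(1) st w(2,3)] by simp_all
    then show "w \<in> W_set mu (encode S)"
      using w(1) js by (simp add: W_set_def mu_rank_encode[OF S] encode_initial reduced_expression_iff)
  }
qed

end

subsection \<open>The maximal element\<close>

context mu_blocks
begin

section \<open>The state of the maximal element\<close>

text \<open>String i of the maximal element has the values \<open>low i + t\<close> with
  \<open>1 \<le> t\<close> and \<open>t \<le> mu ! i\<close>, so t is the relative value of which
  \<open>D_set\<close> speaks.\<close>

definition low :: "nat \<Rightarrow> nat" where
  "low i = sum_list mu - nu mu (Suc i)"

text \<open>The strings of the maximal element carry decreasing intervals of values, so x lies in
  the string that contains position n + 1 - x.\<close>

definition top_block :: "nat \<Rightarrow> nat" where
  "top_block x = block (if x \<in> {1..sum_list mu} then Suc (sum_list mu) - x else x)"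

text \<open>Reflection of the value interval of a string; the constant is the sum of its ends
  \<open>low i + 1\<close> and \<open>low i + mu ! i\<close>.\<close>

definition top_inv :: "nat \<Rightarrow> nat" where
  "top_inv x = (if x \<in> {1..sum_list mu} then 2 * low (top_block x) + mu ! (top_block x) + 1 - x else x)"

definition top_state :: "(nat \<Rightarrow> nat) \<times> (nat \<Rightarrow> nat)" where
  "top_state = (top_block, top_inv)"

lemma low_add: "i < length mu \<Longrightarrow> low i + nu mu i + mu ! i = sum_list mu"
  using nu_le_sum[of mu "Suc i"] by (simp add: low_def nu_Suc)

lemma top_block_iff:
  assumes "i < length mu" "x \<in> {1..sum_list mu}"
  shows "top_block x = i \<longleftrightarrow> low i < x \<and> x \<le> low i + mu ! i"
proof -
  let ?y = "Suc (sum_list mu) - x"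
  have y: "?y \<in> {1..sum_list mu}" using assms by auto
  have "top_block x = i \<longleftrightarrow> nu mu i < ?y \<and> ?y \<le> nu mu (Suc i)"
    using block_eqI[of i ?y] nu_block_less[of ?y] le_nu_block[of ?y] y assms(2)
    by (auto simp: top_block_def)
  moreover have "nu mu i < ?y \<longleftrightarrow> x \<le> low i + mu ! i" "?y \<le> nu mu (Suc i) \<longleftrightarrow> low i < x"
    using low_add[OF assms(1)] assms(2) nu_Suc[OF assms(1)] by auto
  ultimately show ?thesis by blast
qed

lemma top_block_in:
  assumes "i < length mu" "low i < x" "x \<le> low i + mu ! i"
  shows "x \<in> {1..sum_list mu}" "top_block x = i"
proof -
  show "x \<in> {1..sum_list mu}" using assms low_add[OF assms(1)] by auto
  then show "top_block x = i" using top_block_iff assms by blast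
qed

lemma top_block_bounds:
  assumes "x \<in> {1..sum_list mu}"
  obtains i where "top_block x = i" "i < length mu" "low i < x" "x \<le> low i + mu ! i"
    "top_inv x = 2 * low i + mu ! i + 1 - x"
proof -
  have "Suc (sum_list mu) - x \<in> {1..sum_list mu}" using assms by auto
  then have "top_block x < length mu"
    using block_less_length assms by (simp add: top_block_def)
  then show thesis
    using that[OF refl] top_block_iff[OF _ assms, of "top_block x"] assms by (simp add: top_inv_def)
qed

lemma top_inv_in:
  assumes "i < length mu" "low i < x" "x \<le> low i + mu ! i"
  shows "top_inv x = 2 * low i + mu ! i + 1 - x" "low i < top_inv x" "top_inv x \<le> low i + mu ! i"
proof -
  show "top_inv x = 2 * low i + mu ! i + 1 - x"
    using top_block_in[OF assms] by (simp add: top_inv_def)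
  then show "low i < top_inv x" "top_inv x \<le> low i + mu ! i" using assms by auto
qed

lemma top_state_states: "top_state \<in> states"
proof -
  let ?n = "sum_list mu" and ?r = "\<lambda>x. if x \<in> {1..sum_list mu} then Suc (sum_list mu) - x else x"
  have permI: "g permutes {1..?n}" if "\<And>x. x \<notin> {1..?n} \<Longrightarrow> g x = x" "\<And>x. g (g x) = x" for g
    unfolding permutes_def using that by metis
  have "?r permutes {1..?n}" by (rule permI) auto
  moreover have "top_block = block \<circ> ?r" by (simp add: top_block_def fun_eq_iff)
  moreover have inv: "top_inv (top_inv x) = x" and blk: "top_block (top_inv x) = top_block x" for x
  proof -
    have "top_inv (top_inv x) = x \<and> top_block (top_inv x) = top_block x"
    proof (cases "x \<in> {1..?n}")
      case True
      then obtain i where i: "top_block x = i" "i < length mu" "low i < x" "x \<le> low i + mu ! i"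
        by (rule top_block_bounds) blast
      note f = top_inv_in[OF i(2-4)]
      then show ?thesis using top_inv_in(1)[OF i(2) f(2,3)] top_block_in(2)[OF i(2) f(2,3)] i by simp
    qed (auto simp: top_inv_def)
    then show "top_inv (top_inv x) = x" "top_block (top_inv x) = top_block x" by auto
  qed
  moreover have "top_inv permutes {1..?n}"
    by (rule permI) (use inv in \<open>auto simp: top_inv_def\<close>)
  ultimately show ?thesis unfolding states_def top_state_def by blast
qed

lemma encode_top_state: "encode top_state = max_mu_involution mu"
proof -
  let ?n = "sum_list mu"
  have "map top_inv (sorted_list_of_set (fibre top_block i)) =
      rev [?n - nu mu (i + 1) + 1 ..< ?n - nu mu i + 1]" if i: "i < length mu" for i
  proof -
    have eq: "?n - nu mu (i + 1) + 1 = Suc (low i)" "?n - nu mu i + 1 = Suc (low i + mu ! i)"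
      using low_add[OF i] by (simp add: low_def, linarith)
    have mem: "x \<in> fibre top_block i \<longleftrightarrow> low i < x \<and> x \<le> low i + mu ! i" for x
      using top_block_iff[OF i, of x] top_block_in[OF i, of x] by (auto simp: fibre_def)
    have "fibre top_block i = {Suc (low i)..<Suc (low i + mu ! i)}"
      unfolding set_eq_iff mem atLeastLessThan_iff by arith
    then have "map top_inv (sorted_list_of_set (fibre top_block i)) =
        map top_inv [Suc (low i)..<Suc (low i + mu ! i)]"
      by (simp only: sorted_list_of_set_range)
    also have "\<dots> = rev [Suc (low i)..<Suc (low i + mu ! i)]"
    proof (rule nth_equalityI)
      fix t assume "t < length (map top_inv [Suc (low i)..<Suc (low i + mu ! i)])"
      then have t: "t < mu ! i" by (simp del: upt_Suc)
      have "top_inv (Suc (low i) + t) = low i + mu ! i - t"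
        using top_inv_in(1)[OF i, of "Suc (low i) + t"] t by linarith
      then show "map top_inv [Suc (low i)..<Suc (low i + mu ! i)] ! t =
          rev [Suc (low i)..<Suc (low i + mu ! i)] ! t"
        using t by (simp add: rev_nth del: upt_Suc)
    qed simp
    finally show ?thesis unfolding eq .
  qed
  note string = this
  have "map (\<lambda>i. map top_inv (sorted_list_of_set (fibre top_block i))) [0..<length mu] =
      map (\<lambda>i. rev [?n - nu mu (i + 1) + 1 ..< ?n - nu mu i + 1]) [0..<length mu]"
  proof (rule map_cong[OF refl])
    fix i assume "i \<in> set [0..<length mu]"
    then have "i < length mu" by simp
    then show "map top_inv (sorted_list_of_set (fibre top_block i)) =
        rev [?n - nu mu (i + 1) + 1 ..< ?n - nu mu i + 1]" by (rule string)
  qed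
  then show ?thesis
    unfolding encode_def top_state_def max_mu_involution_def Let_def split by (rule arg_cong)
qed

lemma good_top_iff:
  "good (sum_list mu) u top_state \<longleftrightarrow>
    (\<forall>i<length mu. \<forall>t. 1 \<le> t \<and> 2 * t \<le> mu ! i \<longrightarrow>
       u (low i + (mu ! i + 1 - t)) < u (low i + t) \<and>
       \<not> (\<exists>j. t < j \<and> j < mu ! i + 1 - t \<and>
              u (low i + (mu ! i + 1 - t)) < u (low i + j) \<and> u (low i + j) < u (low i + t)))"
    (is "?L \<longleftrightarrow> ?R")
proof
  assume G: ?L
  show ?R
  proof (intro allI impI)
    fix i t assume i: "i < length mu" and t: "1 \<le> t \<and> 2 * t \<le> mu ! i"
    have f: "top_inv (low i + t) = low i + (mu ! i + 1 - t)"
      using t top_inv_in(1)[OF i, of "low i + t"] by simp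
    have "low i + t < top_inv (low i + t)" unfolding f using t by arith
    from goodD(1)[OF G[unfolded top_state_def] this]
      goodD(2)[OF G[unfolded top_state_def], of "low i + t" "low i + j" for j]
    show "u (low i + (mu ! i + 1 - t)) < u (low i + t) \<and>
       \<not> (\<exists>j. t < j \<and> j < mu ! i + 1 - t \<and>
              u (low i + (mu ! i + 1 - t)) < u (low i + j) \<and> u (low i + j) < u (low i + t))"
      unfolding f nat_add_left_cancel_less by blast
  qed
next
  assume R: ?R
  show ?L
    unfolding top_state_def
  proof (rule goodI)
    fix x
    have "u (top_inv x) < u x \<and>
        (\<forall>e. \<not> (x < e \<and> e < top_inv x \<and> u (top_inv x) < u e \<and> u e < u x))"
      if x: "x < top_inv x"
    proof -
      have "x \<in> {1..sum_list mu}" using x by (auto simp: top_inv_def split: if_splits)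
      then obtain i where i: "i < length mu" "low i < x" "x \<le> low i + mu ! i"
        "top_inv x = 2 * low i + mu ! i + 1 - x" by (rule top_block_bounds) blast
      define t where "t = x - low i"
      \<comment> \<open>\<open>x < top_inv x\<close> says that t is less than m + 1 - t for m the
        size of the string, that is, 2t is at most m; the midpoint of an odd string is a fixed
        point.\<close>
      have t: "x = low i + t" "1 \<le> t" "2 * t \<le> mu ! i" "top_inv x = low i + (mu ! i + 1 - t)"
        using i x by (auto simp: t_def)
      note Rt = R[rule_format, OF i(1) conjI[OF t(2,3)]]
      have "\<not> (x < e \<and> e < top_inv x \<and> u (top_inv x) < u e \<and> u e < u x)" for e
      proof (cases "x < e")
        case True
        then have "e = low i + (e - low i)" using t(1) by simp
        then show ?thesis using Rt unfolding t(4) unfolding t(1) by (metis nat_add_left_cancel_less)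
      qed simp
      then show ?thesis using Rt unfolding t(4) unfolding t(1) by blast
    qed
    then show "x < top_inv x \<Longrightarrow> u (top_inv x) < u x"
      and "x < e \<Longrightarrow> e < top_inv x \<Longrightarrow> u (top_inv x) < u e \<Longrightarrow> u e < u x \<Longrightarrow> False" for e
      by (blast, meson order.strict_trans)
  next
    fix x y assume xy: "x \<in> {1..sum_list mu}" "y \<in> {1..sum_list mu}" "top_block x = top_block y"
      "x < y" "top_inv x < top_inv y"
    \<comment> \<open>Reflection is decreasing on a string, so the premises contradict each
      other.\<close>
    then show "u x < u y \<and> u x < u (top_inv y)" by (simp add: top_inv_def)
  qed
qed

text \<open>One compatible and \<open>good\<close> placement suffices, since every reduced word of
  its inverse leads from \<open>initial\<close> to \<open>top_state\<close>.\<close>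

lemma reaches_top: "reaches initial top_state"
proof -
  let ?n = "sum_list mu"
  \<comment> \<open>In a string of size m the relative values are placed as m, 1, m - 1, 2, and so
    on: the larger end m + 1 - t of a cycle at place 2t - 1, directly followed by t at place 2t.
    Adjacent places leave no room for an intermediate value; the midpoint of an odd string comes
    last.\<close>
  define u where "u x = (if x \<in> {1..?n} then
      nu mu (top_block x) + (let t = x - low (top_block x); m = mu ! (top_block x) in
        if 2 * t \<le> m then 2 * t else 2 * (m + 1 - t) - 1)
    else x)" for x
  have u_in: "u (low i + t) = nu mu i + (if 2 * t \<le> mu ! i then 2 * t else 2 * (mu ! i + 1 - t) - 1)"
    if "i < length mu" "1 \<le> t" "t \<le> mu ! i" for i t
    using top_block_in[OF that(1), of "low i + t"] that by (simp add: u_def)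
  have blk: "block (u x) = top_block x" and range: "u x \<in> {1..?n}" if x: "x \<in> {1..?n}" for x
  proof -
    obtain i where i: "top_block x = i" "i < length mu" "low i < x" "x \<le> low i + mu ! i"
      by (rule top_block_bounds[OF x]) blast
    have "nu mu i < u x \<and> u x \<le> nu mu (Suc i)"
      using u_in[OF i(2), of "x - low i"] i by (auto simp: nu_Suc)
    then show "block (u x) = top_block x" "u x \<in> {1..?n}"
      using block_eqI[of i "u x"] i nu_le_sum[of mu "Suc i"] by auto
  qed
  have "inj_on u {1..?n}"
  proof (rule inj_onI)
    fix x y assume xy: "x \<in> {1..?n}" "y \<in> {1..?n}" "u x = u y"
    obtain i where i: "top_block x = i" "i < length mu" "low i < x" "x \<le> low i + mu ! i"
      by (rule top_block_bounds[OF xy(1)]) blast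
    have "top_block y = i" using blk xy i by metis
    then have y: "low i < y" "y \<le> low i + mu ! i" using top_block_iff[OF i(2) xy(2)] by auto
    define s t where "s = x - low i" and "t = y - low i"
    have st: "x = low i + s" "y = low i + t" "1 \<le> s" "1 \<le> t" "s \<le> mu ! i" "t \<le> mu ! i"
      using i y by (auto simp: s_def t_def)
    have "(if 2 * s \<le> mu ! i then 2 * s else 2 * (mu ! i + 1 - s) - 1) =
        (if 2 * t \<le> mu ! i then 2 * t else 2 * (mu ! i + 1 - t) - 1)"
      using xy(3) u_in[OF i(2) st(3,5)] u_in[OF i(2) st(4,6)] st(1,2) by simp
    \<comment> \<open>Smaller ends of cycles occupy even places, all other values odd ones.\<close>
    moreover have "2 * s \<noteq> 2 * (mu ! i + 1 - t) - 1" "2 * (mu ! i + 1 - s) - 1 \<noteq> 2 * t"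
      using st by (auto dest: arg_cong[of _ _ even])
    ultimately have "s = t" using st by (auto split: if_splits)
    then show "x = y" using st by simp
  qed
  then have perm: "u permutes {1..?n}"
    using range by (intro inj_imp_permutes) (auto simp: u_def)
  have "top_block = block \<circ> u"
    using blk by (auto simp: fun_eq_iff u_def top_block_def)
  moreover have "good ?n u top_state"
    unfolding good_top_iff
  proof (intro allI impI)
    fix i t assume i: "i < length mu" and t: "1 \<le> t \<and> 2 * t \<le> mu ! i"
    have "u (low i + (mu ! i + 1 - t)) = nu mu i + (2 * t - 1)" "u (low i + t) = nu mu i + 2 * t"
      using u_in[OF i, of t] u_in[OF i, of "mu ! i + 1 - t"] t by auto
    then show "u (low i + (mu ! i + 1 - t)) < u (low i + t) \<and>
       \<not> (\<exists>j. t < j \<and> j < mu ! i + 1 - t \<and>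
              u (low i + (mu ! i + 1 - t)) < u (low i + j) \<and> u (low i + j) < u (low i + t))"
      using t by auto
  qed
  moreover have w: "inv u permutes {1..?n}" "inv (inv u) = u"
    using permutes_inv[OF perm] permutes_inv_inv[OF perm] by auto
  moreover obtain js where js: "reduced_expression ?n js (inv u)"
    using reduced_expression_exists[OF w(1)] by blast
  ultimately have "top_state = word_step js initial"
    using word_step_reduced[OF js w(1) top_state_states] by (simp add: top_state_def)
  moreover have "set js \<subseteq> {1..<?n}" using js by (simp only: reduced_expression_iff)
  ultimately show ?thesis unfolding reaches_def by (intro exI[of _ js] conjI)
qed

section \<open>Comparison with \<open>D_mu\<close>\<close>

lemma top_block_eq_iff:
  assumes w: "w permutes {1..sum_list mu}"
  shows "top_block = block \<circ> inv w \<longleftrightarrow>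
    (\<forall>i<length mu. set (mu_string mu i w) = {low i<..low i + mu ! i})" (is "?L \<longleftrightarrow> ?R")
proof -
  let ?n = "sum_list mu"
  have inv_in: "inv w x \<in> {1..?n} \<longleftrightarrow> x \<in> {1..?n}" for x
    using permutes_in_image[OF permutes_inv[OF w]] .
  have mem: "x \<in> set (mu_string mu i w) \<longleftrightarrow> x \<in> {1..?n} \<and> block (inv w x) = i"
    if "i < length mu" for i x
  proof -
    have "set (mu_string mu i w) = w ` {nu mu i<..nu mu (Suc i)}"
      by (auto simp: mu_string_def simp del: upt_Suc)
    also have "\<dots> = w ` fibre block i" by (simp add: fibre_block[OF that])
    also have "\<dots> = fibre (block \<circ> inv w) i" by (simp add: fibre_comp[OF w])
    finally show ?thesis by (simp add: fibre_def)
  qed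
  have iv: "x \<in> {low i<..low i + mu ! i} \<longleftrightarrow> x \<in> {1..?n} \<and> top_block x = i"
    if "i < length mu" for i x
    using top_block_iff[OF that] top_block_in[OF that] by auto
  show ?thesis
  proof
    assume ?L
    then have eq: "top_block x = block (inv w x)" for x by (metis comp_apply)
    show ?R
    proof (intro allI impI set_eqI)
      fix i x assume "i < length mu"
      then show "x \<in> set (mu_string mu i w) \<longleftrightarrow> x \<in> {low i<..low i + mu ! i}"
        by (simp only: mem iv eq)
    qed
  next
    assume R: ?R
    show ?L
    proof
      fix x
      show "top_block x = (block \<circ> inv w) x"
      proof (cases "x \<in> {1..?n}")
        case True
        then have i: "block (inv w x) < length mu" using block_less_length inv_in by blast
        then have "x \<in> {low (block (inv w x))<..low (block (inv w x)) + mu ! block (inv w x)}"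
          using R mem True by blast
        then show ?thesis using iv[OF i] by simp
      next
        case False
        then show ?thesis
          using permutes_not_in[OF permutes_inv[OF w] False] by (auto simp: top_block_def)
      qed
    qed
  qed
qed

text \<open>As the entries form an interval, \<open>std_perm\<close> merely shifts positions and
  values, and its inverse is \<open>inv w\<close> shifted by \<open>low i\<close> in the argument
  and by \<open>nu mu i\<close> in the result. Shifts preserve the comparisons that define
  \<open>D_set\<close>.\<close>

lemma std_perm_D_set_iff:
  assumes w: "w permutes {1..sum_list mu}" and i: "i < length mu"
    and set: "set (mu_string mu i w) = {low i<..low i + mu ! i}"
  shows "std_perm (mu_string mu i w) \<in> D_set (mu ! i) \<longleftrightarrow>
    (\<forall>t. 1 \<le> t \<and> 2 * t \<le> mu ! i \<longrightarrow>
       inv w (low i + (mu ! i + 1 - t)) < inv w (low i + t) \<and>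
       \<not> (\<exists>j. t < j \<and> j < mu ! i + 1 - t \<and>
              inv w (low i + (mu ! i + 1 - t)) < inv w (low i + j) \<and> inv w (low i + j) < inv w (low i + t)))"
proof -
  let ?a = "mu_string mu i w" and ?m = "mu ! i" and ?c = "low i" and ?p = "nu mu i"
  define v where "v t = (if 1 \<le> t \<and> t \<le> ?m then inv w (?c + t) - ?p else t)" for t
  have len: "length ?a = ?m" by (simp add: mu_string_def nu_Suc[OF i] del: upt_Suc)
  have nth: "?a ! (t - 1) = w (?p + t)" if "1 \<le> t" "t \<le> ?m" for t
    using that by (simp add: mu_string_def nu_Suc[OF i] del: upt_Suc)
  have w_in: "?c < w (?p + t) \<and> w (?p + t) \<le> ?c + ?m" if "1 \<le> t" "t \<le> ?m" for t
  proof -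
    have "?a ! (t - 1) \<in> set ?a" using that len by (intro nth_mem) simp
    then show ?thesis using nth[OF that] set by simp
  qed
  have std: "std_perm ?a t = (if 1 \<le> t \<and> t \<le> ?m then w (?p + t) - ?c else t)" for t
  proof (cases "1 \<le> t \<and> t \<le> ?m")
    case True
    then have "{y \<in> set ?a. y \<le> ?a ! (t - 1)} = {?c<..w (?p + t)}"
      using nth w_in[of t] unfolding set by auto
    then show ?thesis using True by (simp add: std_perm_def len)
  qed (auto simp: std_perm_def len)
  have v_in: "?p < inv w (?c + t) \<and> inv w (?c + t) \<le> ?p + ?m" if "1 \<le> t" "t \<le> ?m" for t
  proof -
    have "?c + t \<in> set ?a" using that set by simp
    then obtain y where "?c + t = w y" "?p < y" "y \<le> ?p + ?m"
      by (auto simp: mu_string_def nu_Suc[OF i] simp del: upt_Suc)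
    then show ?thesis using permutes_inverses(2)[OF w, of y] by simp
  qed
  have vs: "v (std_perm ?a t) = t" for t
  proof (cases "1 \<le> t \<and> t \<le> ?m")
    case True
    then show ?thesis using w_in[of t] permutes_inverses(2)[OF w] by (auto simp: std v_def)
  qed (auto simp: std v_def)
  have sv: "std_perm ?a (v t) = t" for t
  proof (cases "1 \<le> t \<and> t \<le> ?m")
    case True
    then show ?thesis using v_in[of t] permutes_inverses(1)[OF w] by (auto simp: std v_def)
  qed (auto simp: std v_def)
  have "std_perm ?a permutes {1..?m}"
    unfolding permutes_def using vs sv std by (metis atLeastAtMost_iff)
  moreover have inv: "inv (std_perm ?a) = v"
    by (rule inv_equality) (use vs sv in auto)
  moreover have v_less: "v s < v t \<longleftrightarrow> inv w (?c + s) < inv w (?c + t)"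
    if "1 \<le> s" "s \<le> ?m" "1 \<le> t" "t \<le> ?m" for s t
    using that v_in[of s] v_in[of t] by (auto simp: v_def)
  have key: "(v (?m + 1 - t) < v t \<and> \<not> (\<exists>j. t < j \<and> j < ?m + 1 - t \<and> v (?m + 1 - t) < v j \<and> v j < v t)) \<longleftrightarrow>
      (inv w (?c + (?m + 1 - t)) < inv w (?c + t) \<and>
       \<not> (\<exists>j. t < j \<and> j < ?m + 1 - t \<and>
              inv w (?c + (?m + 1 - t)) < inv w (?c + j) \<and> inv w (?c + j) < inv w (?c + t)))"
    if t: "1 \<le> t" "2 * t \<le> ?m" for t
  proof -
    have t': "t \<le> ?m" "1 \<le> ?m + 1 - t" "?m + 1 - t \<le> ?m" using t by auto
    have "v (?m + 1 - t) < v j \<and> v j < v t \<longleftrightarrow>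
        inv w (?c + (?m + 1 - t)) < inv w (?c + j) \<and> inv w (?c + j) < inv w (?c + t)"
      if "t < j" "j < ?m + 1 - t" for j
      using v_less[of "?m + 1 - t" j] v_less[of j t] that t t' by auto
    then show ?thesis using v_less[OF t'(2,3) t(1) t'(1)] by blast
  qed
  ultimately show ?thesis unfolding D_set_def mem_Collect_eq inv using key by blast
qed

lemma D_mu_eq:
  "D_mu mu = {w. w permutes {1..sum_list mu} \<and> top_block = block \<circ> inv w \<and>
     good (sum_list mu) (inv w) top_state}"
proof -
  have iv: "{j. sum_list mu - nu mu (i + 1) < j \<and> j \<le> sum_list mu - nu mu i} = {low i<..low i + mu ! i}"
    if "i < length mu" for i
    using low_add[OF that] by (auto simp: low_def)
  show ?thesis
    unfolding D_mu_def Let_def good_top_iff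
    using top_block_eq_iff iv std_perm_D_set_iff by (intro Collect_cong) (metis (no_types, lifting))
qed

end

theorem theorem4p10:
  fixes n :: nat and mu :: "nat list"
  assumes "composition n mu"
  shows "W_set mu (max_mu_involution mu) = D_mu mu"
proof -
  interpret mu_blocks mu .
  have "fst top_state = top_block" by (simp add: top_state_def)
  then show ?thesis
    using W_set_encode[OF reaches_top] unfolding encode_top_state D_mu_eq by (simp only:)
qed

end
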